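(* Let $-1\le q<1$, $0<p<2$ and $r\ge p$. Let $\theta$ be a real random variable, let $(\theta_k)_{k\ge 1}$ be a sequence of independent copies of $\theta$, let $(\xi_k)_{k\ge1}$ be the linear autoregression sequence defined by $\xi_1=\theta_1$ and $\xi_k=q\,\xi_{k-1}+\theta_k$ for $k\ge 2$, and let $S_n=\sum_{k=1}^n \xi_k$ for $n\ge 1$. If $r\ge 1$, assume in addition that $\theta$ is centered, i.e. $\mathbb{E}\theta=0$ as soon as $\mathbb{E}|\theta|<\infty$. Then for any $\varepsilon>0$, $$\sum_{n=1}^\infty n^{\frac{r}{p}-2}\,\mathbb{P}\Big\{\frac{|S_n|}{n^{1/p}}>\varepsilon\Big\}<\infty \quad\text{if and only if}\quad \mathbb{E}|\theta|^{r}<\infty .$$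
   Context: All random variables are real-valued and defined on a common probability space $(\Omega,\mathcal{F},\mathbb{P})$; $\mathbb{E}$ denotes expectation. "Independent copies of $\theta$" means that the $\theta_k$ are mutually independent and each has the same distribution as $\theta$. The coefficient $q$ is a real constant. *)

theory Defs
  imports "HOL-Probability.Probability"
begin

end

theory Submission
  imports Defs "HOL-Real_Asymp.Real_Asymp"
begin

text \<open>
  Unrolling the recursion gives \<open>S n = (\<Sum>k=1..n. a (n - k) * \<theta>s k)\<close> with the bounded weights
  \<open>a j = 1 + q + \<dots> + q ^ j\<close>, so sufficiency is a Baum--Katz theorem for weighted sums. Truncate
  the \<open>\<theta>s k\<close> at a small multiple of \<open>n powr (1 / p)\<close>: the discarded part costs
  \<open>n * P(\<bar>\<theta>\<bar> > d * n powr (1 / p))\<close>, whose weighted series converges exactly when \<open>E \<bar>\<theta>\<bar> powr r < \<infinity>\<close>,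
  and the drift of the truncated part is negligible by dominated convergence. The centered truncated
  sum is handled by Chebyshev's inequality for \<open>r < 2\<close> and, for \<open>r \<ge> 2\<close>, by an exponential bound
  whose parameter is tuned to give the decay \<open>n powr (- r / p)\<close>.

  For necessity, \<open>S n - q * S (n - 1)\<close> is the partial sum \<open>T n\<close> of the i.i.d. sequence itself. Since
  \<open>T (m + n) - T m\<close> is distributed as \<open>T n\<close>, averaging over \<open>n < m \<le> 2 * n\<close> shows that
  \<open>T n / n powr (1 / p)\<close> is eventually at most a fixed constant with probability close to \<open>1\<close>. Hence a
  single large summand forces \<open>T n\<close> to be large, which bounds \<open>n * P(\<bar>\<theta>\<bar> > c * n powr (1 / p))\<close> by a
  multiple of \<open>P(\<bar>T n\<bar> > c' * n powr (1 / p))\<close>.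
\<close>

section \<open>Tail series and moments\<close>

lemma sum_powr_le:
  assumes "0 \<le> (a::real)"
  shows "(\<Sum>n=1..N. real n powr a) \<le> real N powr (a + 1)"
proof (cases "N = 0")
  case False
  have "(\<Sum>n=1..N. real n powr a) \<le> of_nat (card {1..N}) * real N powr a"
    by (rule sum_bounded_above) (use assms in \<open>auto intro!: powr_mono2\<close>)
  also have "\<dots> = real N powr (a + 1)"
    using False by (simp add: powr_add)
  finally show ?thesis .
qed simp

text \<open>The upper half of the range contains at least \<open>N / 2\<close> indices, each
  contributing at least \<open>(N / 2) powr a\<close>.\<close>

lemma sum_powr_ge:
  assumes "0 \<le> (a::real)"
  shows "(real N / 2) powr (a + 1) \<le> (\<Sum>n=1..N. real n powr a)"
proof (cases "N = 0")
  case False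
  let ?A = "{(N + 1) div 2..N}"
  have "(real N / 2) powr (a + 1) = real N / 2 * (real N / 2) powr a"
    using False by (simp add: powr_add)
  also have "\<dots> \<le> real (card ?A) * (real N / 2) powr a"
    by (intro mult_right_mono) auto
  also have "\<dots> \<le> (\<Sum>n\<in>?A. real n powr a)"
    by (rule sum_bounded_below) (use assms in \<open>auto intro!: powr_mono2\<close>)
  also have "\<dots> \<le> (\<Sum>n=1..N. real n powr a)"
    using False by (intro sum_mono2) auto
  finally show ?thesis .
qed simp

lemma suminf_ennreal_le:
  assumes "\<And>n. 0 \<le> f n" "\<And>N. (\<Sum>n<N. f n) \<le> c"
  shows "(\<Sum>n. ennreal (f n)) \<le> ennreal c"
  by (rule suminf_le_const[OF summableI]) (use assms in \<open>auto simp: ennreal_leI\<close>)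

text \<open>Summing over the integers below \<open>v\<close> gains one power of \<open>v\<close>.
  Together with \<open>powr_le_suminf_less\<close> this is the deterministic form of the equivalence
  between tail series and moments.\<close>

lemma suminf_powr_less_le:
  fixes a v :: real
  assumes "0 \<le> a" "0 \<le> v"
  shows "(\<Sum>n. ennreal (real n powr a * of_bool (real n < v))) \<le> ennreal (v powr (a + 1))"
proof (rule suminf_ennreal_le)
  fix N
  \<comment> \<open>\<open>0 powr a\<close> is 0 even for \<open>a = 0\<close>, so the index 0 drops
    out.\<close>
  have "(\<Sum>n<N. real n powr a * of_bool (real n < v)) = (\<Sum>n | n < N \<and> 1 \<le> n \<and> real n < v. real n powr a)"
    by (intro sum.mono_neutral_cong_right) auto
  also have "\<dots> \<le> (\<Sum>n=1..nat \<lfloor>v\<rfloor>. real n powr a)"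
    by (intro sum_mono2) (auto simp: le_nat_iff le_floor_iff)
  also have "\<dots> \<le> real (nat \<lfloor>v\<rfloor>) powr (a + 1)"
    by (rule sum_powr_le[OF assms(1)])
  also have "\<dots> \<le> v powr (a + 1)"
    using assms by (intro powr_mono2) auto
  finally show "(\<Sum>n<N. real n powr a * of_bool (real n < v)) \<le> v powr (a + 1)" .
qed auto

text \<open>The summand 1 absorbs \<open>v \<le> 1\<close>, where the series vanishes. The factor
  \<open>4 powr (a + 1)\<close> pays for rounding (\<open>v \<le> N + 1 \<le> 2 * N\<close>) and for
  the halving in \<open>sum_powr_ge\<close>.\<close>

lemma powr_le_suminf_less:
  fixes a v :: real
  assumes "0 \<le> a" "0 \<le> v"
  shows "ennreal (v powr (a + 1)) \<le>
    1 + ennreal (4 powr (a + 1)) * (\<Sum>n. ennreal (real n powr a * of_bool (real n < v)))"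
proof (cases "v \<le> 1")
  case True
  then have "v powr (a + 1) \<le> 1 powr (a + 1)"
    using assms by (intro powr_mono2) auto
  then have "ennreal (v powr (a + 1)) \<le> 1" by simp
  then show ?thesis by (rule order.trans) simp
next
  case False
  \<comment> \<open>\<open>N\<close> is the largest integer strictly below \<open>v\<close>.\<close>
  define N where "N = nat \<lceil>v\<rceil> - 1"
  have N: "1 \<le> N" "real N < v" "v \<le> real N + 1"
    using False unfolding N_def by linarith+
  have "v powr (a + 1) \<le> (4 * (real N / 2)) powr (a + 1)"
    using N assms by (intro powr_mono2) auto
  also have "\<dots> = 4 powr (a + 1) * (real N / 2) powr (a + 1)"
    by (rule powr_mult)
  also have "\<dots> \<le> 4 powr (a + 1) * (\<Sum>n=1..N. real n powr a)"
    by (intro mult_left_mono sum_powr_ge assms) auto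
  also have "(\<Sum>n=1..N. real n powr a) = (\<Sum>n=1..N. real n powr a * of_bool (real n < v))"
    using N by (intro sum.cong) auto
  finally have "ennreal (v powr (a + 1)) \<le>
    ennreal (4 powr (a + 1) * (\<Sum>n=1..N. real n powr a * of_bool (real n < v)))"
    by (rule ennreal_leI)
  also have "\<dots> = ennreal (4 powr (a + 1)) * (\<Sum>n=1..N. ennreal (real n powr a * of_bool (real n < v)))"
    by (subst ennreal_mult) (auto intro!: sum_nonneg)
  also have "\<dots> \<le> ennreal (4 powr (a + 1)) * (\<Sum>n. ennreal (real n powr a * of_bool (real n < v)))"
    by (intro mult_left_mono sum_le_suminf summableI) auto
  finally show ?thesis
    by (rule order.trans) simp
qed

text \<open>The mean value theorem for \<open>x powr (1 - b)\<close> majorises a summand by a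
  difference that telescopes. Its intermediate point is below \<open>x + 1 \<le> 2 * x\<close>,
  whence the factor \<open>2 powr b\<close>.\<close>

lemma powr_minus_le_diff:
  assumes "1 < (b::real)" "1 \<le> x"
  shows "x powr (-b) \<le> 2 powr b / (b - 1) * (x powr (1 - b) - (x + 1) powr (1 - b))"
proof -
  have "\<exists>z. x < z \<and> z < x + 1 \<and>
    (x + 1) powr (1 - b) - x powr (1 - b) = (x + 1 - x) * ((1 - b) * z powr (1 - b - 1))"
    by (rule MVT2) (use assms in \<open>auto intro!: derivative_eq_intros\<close>)
  then obtain z where z: "x < z" "z < x + 1"
    "x powr (1 - b) - (x + 1) powr (1 - b) = (b - 1) * z powr (-b)"
    by (auto simp: algebra_simps)
  have "x powr (-b) = 2 powr b * (2 * x) powr (-b)"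
    using assms by (simp add: powr_mult powr_minus field_simps)
  also have "\<dots> \<le> 2 powr b * z powr (-b)"
    using z assms by (intro mult_left_mono powr_mono2') auto
  also have "\<dots> = 2 powr b / (b - 1) * (x powr (1 - b) - (x + 1) powr (1 - b))"
    using assms z(3) by simp
  finally show ?thesis .
qed

lemma suminf_powr_ge_le:
  assumes "1 < (b::real)" "0 < v"
  shows "(\<Sum>n. ennreal (real n powr (-b) * of_bool (v \<le> real n))) \<le>
    ennreal (2 powr b / (b - 1) * v powr (1 - b))"
proof (rule suminf_ennreal_le)
  fix N
  let ?K = "2 powr b / (b - 1)"
  have K: "0 \<le> ?K" using assms by simp
  \<comment> \<open>Telescoping invariant: with \<open>max v (real N)\<close> the right side stays 0
    until \<open>N\<close> passes \<open>v\<close>, so the induction can start at 0.\<close>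
  have "(\<Sum>n<N. real n powr (-b) * of_bool (v \<le> real n)) \<le>
    ?K * (v powr (1 - b) - (max v (real N)) powr (1 - b))"
  proof (induction N)
    case 0
    then show ?case using assms by (simp add: max_def)
  next
    case (Suc N)
    have "real N powr (-b) * of_bool (v \<le> real N) \<le>
      ?K * ((max v (real N)) powr (1 - b) - (max v (real (Suc N))) powr (1 - b))"
    proof (cases "v \<le> real N")
      case True
      then have "1 \<le> N" using assms by (cases N) auto
      then have "real N powr (-b) \<le> ?K * (real N powr (1 - b) - (real N + 1) powr (1 - b))"
        using assms by (intro powr_minus_le_diff) auto
      then show ?thesis using True by (simp add: max_def add.commute)
    next
      case False
      have "(max v (real (Suc N))) powr (1 - b) \<le> (max v (real N)) powr (1 - b)"
        using assms by (intro powr_mono2') auto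
      then show ?thesis using False mult_nonneg_nonneg[OF K] by simp
    qed
    with Suc.IH show ?case by (simp add: algebra_simps)
  qed
  also have "\<dots> \<le> ?K * v powr (1 - b)"
    using K by (intro mult_left_mono) auto
  finally show "(\<Sum>n<N. real n powr (-b) * of_bool (v \<le> real n)) \<le> ?K * v powr (1 - b)" .
qed auto

section \<open>Tail series and truncated moments of a single random variable\<close>

context prob_space
begin

text \<open>By Tonelli the series equals the expectation of the sum of \<open>n powr a\<close> over
  \<open>n < V\<close>, which is comparable to \<open>V powr (a + 1)\<close>. Computing in
  \<open>ennreal\<close> lets both sides be infinite together.\<close>

lemma summable_tail_iff_integrable:
  fixes V :: "'a \<Rightarrow> real"
  assumes [measurable]: "random_variable borel V" and V: "\<And>\<omega>. 0 \<le> V \<omega>" and a: "0 \<le> (a::real)"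
  shows "summable (\<lambda>n. real n powr a * prob {\<omega>\<in>space M. real n < V \<omega>}) \<longleftrightarrow>
    integrable M (\<lambda>\<omega>. V \<omega> powr (a + 1))"
proof -
  let ?F = "\<lambda>v. \<Sum>n. ennreal (real n powr a * of_bool (real n < v))"
  have "(\<Sum>n. ennreal (real n powr a * prob {\<omega>\<in>space M. real n < V \<omega>})) =
     (\<Sum>n. \<integral>\<^sup>+ \<omega>. ennreal (real n powr a * of_bool (real n < V \<omega>)) \<partial>M)"
  proof (intro suminf_cong)
    fix n
    have "(\<integral>\<^sup>+ \<omega>. ennreal (real n powr a * of_bool (real n < V \<omega>)) \<partial>M) =
       (\<integral>\<^sup>+ \<omega>. ennreal (real n powr a) * indicator {\<omega>\<in>space M. real n < V \<omega>} \<omega> \<partial>M)"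
      by (intro nn_integral_cong) (auto simp: indicator_def)
    then show "ennreal (real n powr a * prob {\<omega>\<in>space M. real n < V \<omega>}) =
        (\<integral>\<^sup>+ \<omega>. ennreal (real n powr a * of_bool (real n < V \<omega>)) \<partial>M)"
      by (simp add: nn_integral_cmult_indicator ennreal_mult emeasure_eq_measure)
  qed
  also have "\<dots> = (\<integral>\<^sup>+ \<omega>. ?F (V \<omega>) \<partial>M)"
    by (intro nn_integral_suminf[symmetric]) measurable
  finally have eq: "(\<Sum>n. ennreal (real n powr a * prob {\<omega>\<in>space M. real n < V \<omega>})) =
    (\<integral>\<^sup>+ \<omega>. ?F (V \<omega>) \<partial>M)" .
  have "summable (\<lambda>n. real n powr a * prob {\<omega>\<in>space M. real n < V \<omega>}) \<longleftrightarrow>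
    (\<Sum>n. ennreal (real n powr a * prob {\<omega>\<in>space M. real n < V \<omega>})) \<noteq> \<top>"
    by (rule iffI, rule ennreal_suminf_neq_top) (auto intro: summable_suminf_not_top)
  also have "\<dots> \<longleftrightarrow> (\<integral>\<^sup>+ \<omega>. ennreal (V \<omega> powr (a + 1)) \<partial>M) < \<infinity>"
    unfolding eq
  proof
    assume "(\<integral>\<^sup>+ \<omega>. ennreal (V \<omega> powr (a + 1)) \<partial>M) < \<infinity>"
    moreover have "(\<integral>\<^sup>+ \<omega>. ?F (V \<omega>) \<partial>M) \<le> (\<integral>\<^sup>+ \<omega>. ennreal (V \<omega> powr (a + 1)) \<partial>M)"
      by (intro nn_integral_mono suminf_powr_less_le a V)
    ultimately show "(\<integral>\<^sup>+ \<omega>. ?F (V \<omega>) \<partial>M) \<noteq> \<top>"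
      by (auto simp: less_top top_unique)
  next
    assume *: "(\<integral>\<^sup>+ \<omega>. ?F (V \<omega>) \<partial>M) \<noteq> \<top>"
    have "(\<integral>\<^sup>+ \<omega>. ennreal (V \<omega> powr (a + 1)) \<partial>M) \<le>
      (\<integral>\<^sup>+ \<omega>. 1 + ennreal (4 powr (a + 1)) * ?F (V \<omega>) \<partial>M)"
      by (intro nn_integral_mono powr_le_suminf_less a V)
    also have "\<dots> = 1 + ennreal (4 powr (a + 1)) * (\<integral>\<^sup>+ \<omega>. ?F (V \<omega>) \<partial>M)"
      by (simp add: nn_integral_add nn_integral_cmult emeasure_space_1)
    also have "\<dots> < \<infinity>"
      using * by (simp add: less_top ennreal_mult_less_top)
    finally show "(\<integral>\<^sup>+ \<omega>. ennreal (V \<omega> powr (a + 1)) \<partial>M) < \<infinity>" .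
  qed
  also have "\<dots> \<longleftrightarrow> integrable M (\<lambda>\<omega>. V \<omega> powr (a + 1))"
    by (simp add: integrable_iff_bounded)
  finally show ?thesis .
qed

text \<open>Exchanging sum and expectation leaves \<open>V powr s\<close> times the tail of
  \<open>n powr (-b)\<close> from \<open>V\<close> on, which is of order
  \<open>V powr (1 - b)\<close>. This controls the truncated second moments when
  \<open>r < 2\<close>.\<close>

lemma summable_truncated_moment:
  fixes V :: "'a \<Rightarrow> real"
  assumes [measurable]: "random_variable borel V" and V: "\<And>\<omega>. 0 \<le> V \<omega>"
    and b: "1 < (b::real)" and s: "0 \<le> s"
    and int: "integrable M (\<lambda>\<omega>. V \<omega> powr (s + 1 - b))"
  shows "summable (\<lambda>n. real n powr (-b) * expectation (\<lambda>\<omega>. V \<omega> powr s * of_bool (V \<omega> \<le> real n)))"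
proof (rule summable_suminf_not_top)
  let ?K = "2 powr b / (b - 1)"
  have int': "integrable M (\<lambda>\<omega>. V \<omega> powr s * of_bool (V \<omega> \<le> real n))" for n
    by (rule integrable_const_bound[where B = "real n powr s"])
      (use V s in \<open>auto intro!: powr_mono2 AE_I2\<close>)
  show "0 \<le> real n powr (-b) * expectation (\<lambda>\<omega>. V \<omega> powr s * of_bool (V \<omega> \<le> real n))" for n
    by (intro mult_nonneg_nonneg integral_nonneg_AE AE_I2) auto
  have "(\<Sum>n. ennreal (real n powr (-b) * expectation (\<lambda>\<omega>. V \<omega> powr s * of_bool (V \<omega> \<le> real n)))) =
    (\<Sum>n. \<integral>\<^sup>+ \<omega>. ennreal (real n powr (-b) * (V \<omega> powr s * of_bool (V \<omega> \<le> real n))) \<partial>M)"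
    by (intro suminf_cong, subst nn_integral_eq_integral) (use int' in auto)
  also have "\<dots> = (\<integral>\<^sup>+ \<omega>. (\<Sum>n. ennreal (real n powr (-b) * (V \<omega> powr s * of_bool (V \<omega> \<le> real n)))) \<partial>M)"
    by (intro nn_integral_suminf[symmetric]) measurable
  also have "\<dots> \<le> (\<integral>\<^sup>+ \<omega>. ennreal (?K * V \<omega> powr (s + 1 - b)) \<partial>M)"
  proof (intro nn_integral_mono)
    fix \<omega>
    have "(\<Sum>n. ennreal (real n powr (-b) * (V \<omega> powr s * of_bool (V \<omega> \<le> real n)))) =
      ennreal (V \<omega> powr s) * (\<Sum>n. ennreal (real n powr (-b) * of_bool (V \<omega> \<le> real n)))"
      by (subst ennreal_suminf_cmult[symmetric], intro suminf_cong, subst ennreal_mult[symmetric])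
        (auto simp: mult_ac)
    also have "\<dots> \<le> ennreal (?K * V \<omega> powr (s + 1 - b))"
    \<comment> \<open>The tail estimate needs a positive threshold; at 0 the factor
      \<open>V \<omega> powr s\<close> vanishes, also for \<open>s = 0\<close>.\<close>
    proof (cases "V \<omega> = 0")
      case False
      then have "0 < V \<omega>" using V[of \<omega>] by simp
      then have "ennreal (V \<omega> powr s) * (\<Sum>n. ennreal (real n powr (-b) * of_bool (V \<omega> \<le> real n))) \<le>
        ennreal (V \<omega> powr s) * ennreal (?K * V \<omega> powr (1 - b))"
        using b by (intro mult_left_mono suminf_powr_ge_le) auto
      also have "\<dots> = ennreal (?K * (V \<omega> powr s * V \<omega> powr (1 - b)))"
        using b by (subst ennreal_mult[symmetric]) (auto simp: mult_ac)
      finally show ?thesis by (simp add: powr_add[symmetric] add_diff_eq)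
    qed simp
    finally show "(\<Sum>n. ennreal (real n powr (-b) * (V \<omega> powr s * of_bool (V \<omega> \<le> real n)))) \<le>
      ennreal (?K * V \<omega> powr (s + 1 - b))" .
  qed
  also have "\<dots> = ennreal (expectation (\<lambda>\<omega>. ?K * V \<omega> powr (s + 1 - b)))"
    using b by (intro nn_integral_eq_integral integrable_mult_right int AE_I2) auto
  also have "\<dots> < \<top>" by simp
  finally show "(\<Sum>n. ennreal (real n powr (-b) * expectation (\<lambda>\<omega>. V \<omega> powr s * of_bool (V \<omega> \<le> real n)))) \<noteq> \<top>"
    by simp
qed

end

lemma less_powr_iff:
  assumes "0 < (p::real)" "0 \<le> x" "0 \<le> y"
  shows "x < y powr p \<longleftrightarrow> x powr (1 / p) < y"
proof -
  have "x = (x powr (1 / p)) powr p" using assms by (simp add: powr_powr)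
  then show ?thesis
    using assms powr_less_mono2[of p "x powr (1 / p)" y] powr_mono2[of p y "x powr (1 / p)"]
    by (cases "x powr (1 / p) < y") auto
qed

context prob_space
begin

text \<open>The substitution \<open>V = (\<bar>Z\<bar> / c) powr p\<close> turns the level
  \<open>c * n powr (1 / p)\<close> for \<open>\<bar>Z\<bar>\<close> into the level \<open>n\<close>
  for \<open>V\<close>, and \<open>p \<le> r\<close> makes the exponent \<open>r / p - 1\<close>
  nonnegative.\<close>

lemma summable_tail_iff_abs_powr_integrable:
  fixes Z :: "'a \<Rightarrow> real"
  assumes [measurable]: "random_variable borel Z" and p: "0 < (p::real)" "p \<le> r" and c: "0 < c"
  shows "summable (\<lambda>n. real n powr (r / p - 1) * prob {\<omega>\<in>space M. c * real n powr (1 / p) < \<bar>Z \<omega>\<bar>})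
    \<longleftrightarrow> integrable M (\<lambda>\<omega>. \<bar>Z \<omega>\<bar> powr r)"
proof -
  define V where "V \<omega> = (\<bar>Z \<omega>\<bar> / c) powr p" for \<omega>
  have "{\<omega>\<in>space M. real n < V \<omega>} = {\<omega>\<in>space M. c * real n powr (1 / p) < \<bar>Z \<omega>\<bar>}" for n
    using p c by (auto simp: V_def less_powr_iff field_simps)
  moreover have "V \<omega> powr (r / p - 1 + 1) = \<bar>Z \<omega>\<bar> powr r / c powr r" for \<omega>
    using p c by (simp add: V_def powr_powr powr_divide)
  moreover have "summable (\<lambda>n. real n powr (r / p - 1) * prob {\<omega>\<in>space M. real n < V \<omega>}) \<longleftrightarrow>
    integrable M (\<lambda>\<omega>. V \<omega> powr (r / p - 1 + 1))"
    by (rule summable_tail_iff_integrable) (use p in \<open>auto simp: V_def\<close>)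
  moreover have "integrable M (\<lambda>\<omega>. \<bar>Z \<omega>\<bar> powr r / c powr r) \<longleftrightarrow> integrable M (\<lambda>\<omega>. \<bar>Z \<omega>\<bar> powr r)"
    using c by (simp add: divide_inverse)
  ultimately show ?thesis by simp
qed

lemma prob_distr_eq:
  assumes "random_variable borel U" "random_variable borel V" "distr M borel U = distr M borel V" "A \<in> sets borel"
  shows "prob {\<omega>\<in>space M. U \<omega> \<in> A} = prob {\<omega>\<in>space M. V \<omega> \<in> A}"
  using measure_distr[OF assms(1,4)] measure_distr[OF assms(2,4)] assms(3)
  by (simp add: vimage_def Int_def conj_commute)

end

section \<open>Necessity for i.i.d. partial sums\<close>

text \<open>\<open>X 0\<close> is left unconstrained to match a sequence indexed from 1, so index
  sets below stay inside \<open>{1..}\<close>. The common law is given through a reference variable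
  \<open>Z\<close>.\<close>

locale iid_sequence = prob_space M for M :: "'a measure" +
  fixes X :: "nat \<Rightarrow> 'a \<Rightarrow> real" and Z :: "'a \<Rightarrow> real"
  assumes Z_measurable [measurable]: "random_variable borel Z"
    and indep: "indep_vars (\<lambda>_. borel) X {1..}"
    and ident: "\<And>k. 1 \<le> k \<Longrightarrow> distr M borel (X k) = distr M borel Z"
begin

lemma X_measurable [measurable]: "1 \<le> k \<Longrightarrow> random_variable borel (X k)"
  using indep by (auto simp: indep_vars_def)

lemma sum_X_measurable [measurable]: "A \<subseteq> {1..} \<Longrightarrow> random_variable borel (\<lambda>\<omega>. \<Sum>k\<in>A. X k \<omega>)"
  by (intro borel_measurable_sum X_measurable) auto

lemma expectation_X:
  assumes "1 \<le> k" "f \<in> borel_measurable borel"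
  shows "expectation (\<lambda>\<omega>. f (X k \<omega>)) = (expectation (\<lambda>\<omega>. f (Z \<omega>)) :: real)"
  using integral_distr[OF X_measurable[OF assms(1)] assms(2)] integral_distr[OF Z_measurable assms(2)]
  by (simp add: ident[OF assms(1)])

lemma prob_X:
  assumes "1 \<le> k" "A \<in> sets borel"
  shows "prob {\<omega>\<in>space M. X k \<omega> \<in> A} = prob {\<omega>\<in>space M. Z \<omega> \<in> A}"
  by (intro prob_distr_eq X_measurable Z_measurable ident assms)

lemma indep_X_sum:
  assumes "finite A" "insert k A \<subseteq> {1..}" "k \<notin> A"
  shows "indep_var borel (X k) borel (\<lambda>\<omega>. \<Sum>j\<in>A. X j \<omega>)"
  by (intro indep_vars_sum indep_vars_subset[OF indep] assms)

text \<open>The law of such a sum is a repeated convolution of the law of \<open>Z\<close>, so only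
  the number of summands matters. The induction peels one index off each set.\<close>

lemma distr_sum_cong:
  assumes "finite A" "finite B" "card A = card B" "A \<subseteq> {1..}" "B \<subseteq> {1..}"
  shows "distr M borel (\<lambda>\<omega>. \<Sum>k\<in>A. X k \<omega>) = distr M borel (\<lambda>\<omega>. \<Sum>k\<in>B. X k \<omega>)"
  using assms
proof (induction A arbitrary: B rule: finite_induct)
  case (insert k A)
  then obtain l B' where B: "B = insert l B'" "l \<notin> B'"
    by (metis Set.set_insert card.empty card_insert_disjoint ex_in_conv nat.distinct(1))
  have split: "distr M borel (\<lambda>\<omega>. \<Sum>k\<in>insert i C. X k \<omega>) =
    convolution (distr M borel Z) (distr M borel (\<lambda>\<omega>. \<Sum>k\<in>C. X k \<omega>))"
    if "finite C" "i \<notin> C" "insert i C \<subseteq> {1..}" for i C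
    using sum_indep_random_variable[OF indep_X_sum[OF that(1,3,2)] X_measurable sum_X_measurable] that
    by (simp add: ident)
  have "distr M borel (\<lambda>\<omega>. \<Sum>k\<in>A. X k \<omega>) = distr M borel (\<lambda>\<omega>. \<Sum>k\<in>B'. X k \<omega>)"
    using insert B by (intro insert.IH) auto
  moreover have "finite B'" "l \<notin> B'" "insert l B' \<subseteq> {1..}" "insert k A \<subseteq> {1..}"
    using insert.prems B by auto
  ultimately show ?case
    unfolding B by (simp only: split insert.hyps simp_thms)
qed auto

lemma prob_indep_X_sum:
  assumes "finite A" "insert k A \<subseteq> {1..}" "k \<notin> A" "U \<in> sets borel" "V \<in> sets borel"
  shows "prob {\<omega>\<in>space M. X k \<omega> \<in> U \<and> (\<Sum>j\<in>A. X j \<omega>) \<in> V} =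
    prob {\<omega>\<in>space M. Z \<omega> \<in> U} * prob {\<omega>\<in>space M. (\<Sum>j\<in>A. X j \<omega>) \<in> V}"
  using indep_varD[OF indep_X_sum[OF assms(1-3)] assms(4,5)] prob_X[OF _ assms(4), of k] assms(2)
  by (simp add: vimage_def Int_def conj_commute conj_left_commute)

lemma prob_sum_cong:
  assumes "finite A" "finite B" "card A = card B" "A \<subseteq> {1..}" "B \<subseteq> {1..}" "U \<in> sets borel"
  shows "prob {\<omega>\<in>space M. (\<Sum>k\<in>A. X k \<omega>) \<in> U} = prob {\<omega>\<in>space M. (\<Sum>k\<in>B. X k \<omega>) \<in> U}"
  by (intro prob_distr_eq sum_X_measurable distr_sum_cong assms)

text \<open>If exactly one of the first \<open>m\<close> summands exceeds \<open>2 * x\<close> while the sum of all the others is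
  at most \<open>x\<close>, then the whole sum exceeds \<open>x\<close>; these \<open>m\<close> events are disjoint.\<close>

lemma prob_sum_gt_ge:
  fixes m n :: nat
  assumes "m \<le> n" and x: "0 \<le> x"
  defines "\<tau> \<equiv> prob {\<omega>\<in>space M. 2 * x < \<bar>Z \<omega>\<bar>}"
  defines "\<rho> \<equiv> prob {\<omega>\<in>space M. \<bar>\<Sum>k=1..n-1. X k \<omega>\<bar> \<le> x}"
  shows "real m * \<tau> * (\<rho> - real m * \<tau>) \<le> prob {\<omega>\<in>space M. x < \<bar>\<Sum>k=1..n. X k \<omega>\<bar>}"
proof -
  define U V where "U = {z::real. 2 * x < \<bar>z\<bar>}" and "V = {z::real. \<bar>z\<bar> \<le> x}"
  have [measurable]: "U \<in> sets borel" "V \<in> sets borel" by (auto simp: U_def V_def)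
  define E where "E k = {\<omega>\<in>space M. X k \<omega> \<in> U \<and> (\<Sum>j\<in>{1..n}-{k}. X j \<omega>) \<in> V}" for k
  define D where "D k j = {\<omega>\<in>space M. X k \<omega> \<in> U \<and> X j \<omega> \<in> U}" for k j
  \<comment> \<open>Removing the double exceedances makes the \<open>B k\<close> disjoint and costs
    each of them at most \<open>m\<close> times the square of \<open>\<tau>\<close> in
    probability.\<close>
  define B where "B k = E k - (\<Union>j\<in>{1..m}-{k}. D k j)" for k
  have E_ev: "E k \<in> events" if "1 \<le> k" for k
  proof -
    have [measurable]: "random_variable borel (X k)" "random_variable borel (\<lambda>\<omega>. \<Sum>j\<in>{1..n}-{k}. X j \<omega>)"
      using that by (auto intro: X_measurable sum_X_measurable)
    show ?thesis unfolding E_def by measurable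
  qed
  have D_ev: "D k j \<in> events" if "1 \<le> k" "1 \<le> j" for k j
  proof -
    have [measurable]: "random_variable borel (X k)" "random_variable borel (X j)"
      using that by (auto intro: X_measurable)
    show ?thesis unfolding D_def by measurable
  qed
  have B_ev: "B k \<in> events" if "1 \<le> k" for k
    unfolding B_def using that by (intro sets.Diff E_ev sets.finite_UN D_ev) auto
  have E: "prob (E k) = \<tau> * \<rho>" if k: "k \<in> {1..n}" for k
  proof -
    have "prob (E k) = prob {\<omega>\<in>space M. Z \<omega> \<in> U} * prob {\<omega>\<in>space M. (\<Sum>j\<in>{1..n}-{k}. X j \<omega>) \<in> V}"
      unfolding E_def using k by (intro prob_indep_X_sum) auto
    \<comment> \<open>All sums of \<open>n - 1\<close> distinct summands have the same law,
      whichever index is left out.\<close>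
    also have "prob {\<omega>\<in>space M. (\<Sum>j\<in>{1..n}-{k}. X j \<omega>) \<in> V} = prob {\<omega>\<in>space M. (\<Sum>j=1..n-1. X j \<omega>) \<in> V}"
      using k by (intro prob_sum_cong) auto
    finally show ?thesis by (simp add: \<tau>_def \<rho>_def U_def V_def)
  qed
  have D: "prob (D k j) = \<tau> * \<tau>" if "1 \<le> k" "1 \<le> j" "j \<noteq> k" for k j
    using prob_indep_X_sum[of "{j}" k U U] prob_X[of j U] that by (simp add: D_def \<tau>_def U_def)
  have "\<tau> * \<rho> - real m * (\<tau> * \<tau>) \<le> prob (B k)" if k: "k \<in> {1..m}" for k
  proof -
    have "\<tau> * \<rho> = prob (E k)" using E[of k] k assms by auto
    also have "\<dots> \<le> prob (B k \<union> (\<Union>j\<in>{1..m}-{k}. D k j))"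
      using k by (intro finite_measure_mono sets.Un B_ev sets.finite_UN D_ev) (auto simp: B_def)
    also have "\<dots> \<le> prob (B k) + prob (\<Union>j\<in>{1..m}-{k}. D k j)"
      using k by (intro measure_Un_le B_ev sets.finite_UN D_ev) auto
    also have "prob (\<Union>j\<in>{1..m}-{k}. D k j) \<le> (\<Sum>j\<in>{1..m}-{k}. prob (D k j))"
      using k by (intro finite_measure_subadditive_finite) (auto intro!: D_ev)
    also have "\<dots> = (\<Sum>j\<in>{1..m}-{k}. \<tau> * \<tau>)"
      using k by (intro sum.cong D) auto
    also have "\<dots> \<le> real m * (\<tau> * \<tau>)"
      using k by (auto intro!: mult_right_mono)
    finally show ?thesis by simp
  qed
  then have "(\<Sum>k=1..m. \<tau> * \<rho> - real m * (\<tau> * \<tau>)) \<le> (\<Sum>k=1..m. prob (B k))"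
    by (rule sum_mono)
  also have "\<dots> = prob (\<Union>k\<in>{1..m}. B k)"
  proof (rule finite_measure_finite_Union[symmetric])
    show "disjoint_family_on B {1..m}"
      by (auto simp: disjoint_family_on_def B_def E_def D_def)
  qed (auto intro: B_ev)
  also have "\<dots> \<le> prob {\<omega>\<in>space M. x < \<bar>\<Sum>k=1..n. X k \<omega>\<bar>}"
  proof (rule finite_measure_mono)
    show "(\<Union>k\<in>{1..m}. B k) \<subseteq> {\<omega>\<in>space M. x < \<bar>\<Sum>k=1..n. X k \<omega>\<bar>}"
    proof safe
      fix \<omega> k assume "\<omega> \<in> B k" and k: "k \<in> {1..m}"
      then have "\<omega> \<in> space M" "2 * x < \<bar>X k \<omega>\<bar>" "\<bar>\<Sum>j\<in>{1..n}-{k}. X j \<omega>\<bar> \<le> x"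
        by (auto simp: B_def E_def U_def V_def)
      moreover have "(\<Sum>j=1..n. X j \<omega>) = X k \<omega> + (\<Sum>j\<in>{1..n}-{k}. X j \<omega>)"
        using k assms by (intro sum.remove) auto
      ultimately show "\<omega> \<in> space M" "x < \<bar>\<Sum>k=1..n. X k \<omega>\<bar>" by linarith+
    qed
    have [measurable]: "random_variable borel (\<lambda>\<omega>. \<Sum>k=1..n. X k \<omega>)"
      by (intro sum_X_measurable) auto
    show "{\<omega>\<in>space M. x < \<bar>\<Sum>k=1..n. X k \<omega>\<bar>} \<in> events" by measurable
  qed
  finally show ?thesis by (simp add: algebra_simps)
qed

text \<open>For \<open>n < m \<le> 2 * n\<close> the increment from \<open>m\<close> to
  \<open>m + n\<close> has the law of a sum of \<open>n\<close> terms, so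
  \<open>Q n \<le> P m + P (m + n)\<close>. Averaging over \<open>m\<close> bounds
  \<open>Q n\<close> by a block of the convergent series of \<open>P m / m\<close>.\<close>

lemma partial_sums_bounded_in_prob:
  assumes p: "0 < (p::real)" and a: "-1 \<le> a" and c: "0 < c"
    and sm: "summable (\<lambda>n. real n powr a * prob {\<omega>\<in>space M. c * real n powr (1 / p) < \<bar>\<Sum>k=1..n. X k \<omega>\<bar>})"
  shows "(\<lambda>n. prob {\<omega>\<in>space M. 2 * c * 3 powr (1 / p) * real n powr (1 / p) < \<bar>\<Sum>k=1..n. X k \<omega>\<bar>}) \<longlonglongrightarrow> 0"
proof -
  define P where "P n = prob {\<omega>\<in>space M. c * real n powr (1 / p) < \<bar>\<Sum>k=1..n. X k \<omega>\<bar>}" for n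
  define Q where "Q n = prob {\<omega>\<in>space M. 2 * c * 3 powr (1 / p) * real n powr (1 / p) < \<bar>\<Sum>k=1..n. X k \<omega>\<bar>}" for n
  have P0: "0 \<le> P n" for n by (simp add: P_def)
  \<comment> \<open>Since \<open>-1 \<le> a\<close>, the given weights dominate
    \<open>1 / n\<close>, the weight suited to averaging over blocks of length proportional to
    \<open>n\<close>.\<close>
  have smP: "summable (\<lambda>n. P n / real n)"
  proof (rule summable_comparison_test'[OF sm])
    fix n :: nat assume "1 \<le> n"
    then have "1 / real n \<le> real n powr a"
      using powr_mono[OF a, of "real n"] by (simp add: powr_minus inverse_eq_divide)
    from mult_right_mono[OF this P0[of n]] show "norm (P n / real n) \<le> real n powr a *
        prob {\<omega>\<in>space M. c * real n powr (1 / p) < \<bar>\<Sum>k=1..n. X k \<omega>\<bar>}"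
      using P0[of n] by (simp add: P_def)
  qed
  \<comment> \<open>\<open>A\<close> leaves out its upper index, hence the \<open>Suc\<close> when
    cutting out the block from \<open>n + 1\<close> to \<open>3 * n\<close>.\<close>
  define A where "A n = (\<Sum>m<n. P m / real m)" for n
  have lim: "(\<lambda>n. 3 * (A (Suc (3 * n)) - A (Suc n))) \<longlonglongrightarrow> 0"
  proof -
    have A: "A \<longlonglongrightarrow> (\<Sum>n. P n / real n)"
      unfolding A_def using summable_LIMSEQ[OF smP] .
    have "(\<lambda>n. A (Suc (3 * n))) \<longlonglongrightarrow> (\<Sum>n. P n / real n)" "(\<lambda>n. A (Suc n)) \<longlonglongrightarrow> (\<Sum>n. P n / real n)"
      using LIMSEQ_subseq_LIMSEQ[OF A, of "\<lambda>n. Suc (3 * n)"] LIMSEQ_subseq_LIMSEQ[OF A, of Suc]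
      by (auto simp: strict_mono_def o_def)
    from tendsto_mult_left[OF tendsto_diff[OF this], of 3] show ?thesis by simp
  qed
  \<comment> \<open>If the increment exceeds its level, one of the two end sums exceeds half of it.
    The factor \<open>3 powr (1 / p)\<close> in the level covers
    \<open>m + n \<le> 3 * n\<close>.\<close>
  have le: "Q n \<le> P m + P (m + n)" if m: "m \<in> {n+1..2*n}" for n m
  proof -
    let ?x = "2 * c * 3 powr (1 / p) * real n powr (1 / p)"
    have [measurable]: "random_variable borel (\<lambda>\<omega>. \<Sum>k=1..i. X k \<omega>)" for i
      by (intro sum_X_measurable) auto
    have split: "(\<Sum>k=1..m+n. X k \<omega>) = (\<Sum>k=1..m. X k \<omega>) + (\<Sum>k=m+1..m+n. X k \<omega>)" for \<omega>
      by (subst sum.ub_add_nat) auto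
    have "3 powr (1 / p) * real n powr (1 / p) = real (3 * n) powr (1 / p)"
      by (simp add: powr_mult)
    then have x: "c * real m powr (1 / p) \<le> ?x / 2" "c * real (m + n) powr (1 / p) \<le> ?x / 2"
      using p c m by (auto simp del: of_nat_mult of_nat_add intro!: powr_mono2 mult_left_mono)
    have "Q n = prob {\<omega>\<in>space M. (\<Sum>k=1..n. X k \<omega>) \<in> {z. ?x < \<bar>z\<bar>}}"
      by (simp add: Q_def)
    also have "\<dots> = prob {\<omega>\<in>space M. (\<Sum>k=m+1..m+n. X k \<omega>) \<in> {z. ?x < \<bar>z\<bar>}}"
      by (intro prob_sum_cong) auto
    also have "\<dots> \<le> prob ({\<omega>\<in>space M. c * real m powr (1 / p) < \<bar>\<Sum>k=1..m. X k \<omega>\<bar>} \<union>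
      {\<omega>\<in>space M. c * real (m + n) powr (1 / p) < \<bar>\<Sum>k=1..m+n. X k \<omega>\<bar>})"
    proof (rule finite_measure_mono)
      show "{\<omega>\<in>space M. (\<Sum>k=m+1..m+n. X k \<omega>) \<in> {z. ?x < \<bar>z\<bar>}} \<subseteq>
        {\<omega>\<in>space M. c * real m powr (1 / p) < \<bar>\<Sum>k=1..m. X k \<omega>\<bar>} \<union>
        {\<omega>\<in>space M. c * real (m + n) powr (1 / p) < \<bar>\<Sum>k=1..m+n. X k \<omega>\<bar>}"
        unfolding split using x by (auto simp del: of_nat_add)
    qed measurable
    also have "\<dots> \<le> P m + P (m + n)"
      unfolding P_def by (rule measure_Un_le) measurable
    finally show ?thesis .
  qed
  \<comment> \<open>The indices \<open>m\<close> and \<open>m + n\<close> together run exactly once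
    through \<open>n + 1..3 * n\<close>, where \<open>1 \<le> 3 * n / m\<close>.\<close>
  have bound: "Q n \<le> 3 * (A (Suc (3 * n)) - A (Suc n))" if "1 \<le> n" for n
  proof -
    have "real n * Q n = (\<Sum>m=n+1..2*n. Q n)" by simp
    also have "\<dots> \<le> (\<Sum>m=n+1..2*n. P m + P (m + n))"
      by (intro sum_mono le)
    also have "\<dots> = (\<Sum>m=n+1..2*n. P m) + (\<Sum>m=n+1+n..2*n+n. P m)"
      by (simp only: sum.distrib sum.shift_bounds_cl_nat_ivl)
    also have "\<dots> = (\<Sum>m=n+1..2*n+n. P m)"
    proof -
      have "n + 1 + n = 2 * n + 1" by simp
      then show ?thesis by (simp only: sum.ub_add_nat[of "n + 1" "2 * n" P n])
    qed
    also have "\<dots> \<le> (\<Sum>m=n+1..2*n+n. 3 * real n * (P m / real m))"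
    proof (rule sum_mono)
      fix m assume m: "m \<in> {n+1..2*n+n}"
      then have "real m * P m \<le> 3 * real n * P m"
        by (intro mult_right_mono P0) auto
      then show "P m \<le> 3 * real n * (P m / real m)"
        using m by (simp add: field_simps)
    qed
    also have "\<dots> = 3 * real n * (\<Sum>m=n+1..2*n+n. P m / real m)"
      by (simp add: sum_distrib_left)
    also have "(\<Sum>m=n+1..2*n+n. P m / real m) = A (Suc (3 * n)) - A (Suc n)"
    proof -
      have n3: "2 * n + n = 3 * n" by simp
      have "Suc n \<le> Suc (3 * n)" by simp
      then have "A (Suc (3 * n)) - A (Suc n) = (\<Sum>m=Suc n..<Suc (3 * n). P m / real m)"
        unfolding A_def lessThan_atLeast0 by (intro sum_diff_nat_ivl le0)
      then show ?thesis
        by (simp only: n3 atLeastLessThanSuc_atLeastAtMost flip: Suc_eq_plus1)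
    qed
    finally have "real n * Q n \<le> real n * (3 * (A (Suc (3 * n)) - A (Suc n)))"
      by (simp add: algebra_simps)
    then show ?thesis using that by simp
  qed
  have "Q \<longlonglongrightarrow> 0"
  proof (rule tendsto_sandwich[OF _ _ tendsto_const lim])
    show "\<forall>\<^sub>F n in sequentially. 0 \<le> Q n" by (simp add: Q_def)
    show "\<forall>\<^sub>F n in sequentially. Q n \<le> 3 * (A (Suc (3 * n)) - A (Suc n))"
      using eventually_ge_at_top[of 1] by eventually_elim (rule bound)
  qed
  then show ?thesis unfolding Q_def .
qed

text \<open>Once \<open>\<rho> n \<ge> 1 / 2\<close> and \<open>n * \<tau> n \<le> 1 / 8\<close>,
  \<open>prob_sum_gt_ge\<close> with \<open>m = n\<close> gives
  \<open>n * \<tau> n \<le> 4 * P n\<close>. The factor \<open>n\<close> raises the exponent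
  \<open>r / p - 2\<close> to the \<open>r / p - 1\<close> of the tail series.\<close>

lemma partial_sums_imp_integrable:
  assumes p: "0 < (p::real)" "p \<le> r" and c: "0 < c"
    and sm: "summable (\<lambda>n. real n powr (r / p - 2) *
      prob {\<omega>\<in>space M. c * real n powr (1 / p) < \<bar>\<Sum>k=1..n. X k \<omega>\<bar>})"
  shows "integrable M (\<lambda>\<omega>. \<bar>Z \<omega>\<bar> powr r)"
proof -
  define C where "C = 2 * c * 3 powr (1 / p)"
  define x where "x n = C * real n powr (1 / p)" for n
  define P where "P n = prob {\<omega>\<in>space M. c * real n powr (1 / p) < \<bar>\<Sum>k=1..n. X k \<omega>\<bar>}" for n
  define Q where "Q n = prob {\<omega>\<in>space M. x n < \<bar>\<Sum>k=1..n. X k \<omega>\<bar>}" for n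
  define \<tau> where "\<tau> n = prob {\<omega>\<in>space M. 2 * x n < \<bar>Z \<omega>\<bar>}" for n
  define \<rho> where "\<rho> n = prob {\<omega>\<in>space M. \<bar>\<Sum>k=1..n-1. X k \<omega>\<bar> \<le> x n}" for n
  have "1 \<le> 3 powr (1 / p)" using p by (intro ge_one_powr_ge_zero) auto
  from mult_left_mono[OF this, of "2 * c"] have C: "c \<le> C" "0 < C"
    using c by (auto simp: C_def)
  have x_mono: "x m \<le> x n" if "m \<le> n" for m n
    using that C p by (auto simp: x_def intro!: mult_left_mono powr_mono2)
  have x0: "0 \<le> x n" for n using C by (simp add: x_def)
  have [measurable]: "random_variable borel (\<lambda>\<omega>. \<Sum>k=1..i. X k \<omega>)" for i
    by (intro sum_X_measurable) auto
  have QP: "Q n \<le> P n" for n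
    unfolding P_def Q_def x_def
    by (intro finite_measure_mono) (auto intro!: le_less_trans[OF mult_right_mono[OF C(1)]])
  have Q_lim: "Q \<longlonglongrightarrow> 0"
    unfolding Q_def x_def C_def by (rule partial_sums_bounded_in_prob[OF p(1) _ c sm]) (use p in auto)
  \<comment> \<open>\<open>\<rho> n\<close> concerns \<open>n - 1\<close> summands at level
    \<open>x n\<close>; raising the level from \<open>x (n - 1)\<close> only increases the
    probability.\<close>
  have \<rho>: "1 - Q (n - 1) \<le> \<rho> n" for n
  proof -
    have "1 - Q (n - 1) = prob (space M - {\<omega>\<in>space M. x (n - 1) < \<bar>\<Sum>k=1..n-1. X k \<omega>\<bar>})"
      unfolding Q_def by (rule prob_compl[symmetric]) measurable
    also have "\<dots> \<le> \<rho> n"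
      unfolding \<rho>_def by (intro finite_measure_mono) (auto intro: order.trans[OF _ x_mono[of "n - 1" n]])
    finally show ?thesis .
  qed
  \<comment> \<open>Continuity from above: the levels \<open>x n\<close> increase to infinity, so no
    outcome lies in all the events.\<close>
  have \<tau>_lim: "\<tau> \<longlonglongrightarrow> 0"
  proof -
    let ?D = "\<lambda>n. {\<omega>\<in>space M. 2 * x n < \<bar>Z \<omega>\<bar>}"
    have "filterlim (\<lambda>n. 2 * (C * real n powr (1 / p))) at_top sequentially"
      using p C by real_asymp
    then have "\<forall>\<^sub>F n in sequentially. \<bar>Z \<omega>\<bar> \<le> 2 * x n" for \<omega>
      unfolding x_def filterlim_at_top by blast
    then have bdd: "\<exists>n. \<bar>Z \<omega>\<bar> \<le> 2 * x n" for \<omega>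
      by (rule eventually_happens'[OF sequentially_bot])
    have empty: "(\<Inter>n. ?D n) = {}"
    proof (rule equals0I)
      fix \<omega> assume "\<omega> \<in> (\<Inter>n. ?D n)"
      then have "\<forall>n. 2 * x n < \<bar>Z \<omega>\<bar>" by simp
      with bdd[of \<omega>] show False by (meson not_less)
    qed
    have "decseq ?D"
      unfolding decseq_def by (auto intro: le_less_trans[OF mult_left_mono[OF x_mono]])
    then have "(\<lambda>n. prob (?D n)) \<longlonglongrightarrow> prob (\<Inter>n. ?D n)"
      by (intro finite_Lim_measure_decseq) auto
    then show ?thesis unfolding empty \<tau>_def by simp
  qed
  have Q_ge: "real m * \<tau> n * (\<rho> n - real m * \<tau> n) \<le> Q n" if "m \<le> n" for m n
    unfolding \<tau>_def \<rho>_def Q_def by (rule prob_sum_gt_ge[OF that x0])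
  \<comment> \<open>\<open>1 / 32\<close> is the product of the \<open>1 / 8\<close> and
    \<open>1 / 4\<close> obtained in the contradiction below, and \<open>Q (n - 1) < 1 / 2\<close>
    yields \<open>\<rho> n \<ge> 1 / 2\<close>.\<close>
  have ev: "\<forall>\<^sub>F n in sequentially. Q n < 1 / 32 \<and> Q (n - 1) < 1 / 2 \<and> \<tau> n < 1 / 8"
  proof (intro eventually_conj)
    have "(\<lambda>n. Q (n - 1)) \<longlonglongrightarrow> 0"
      by (rule LIMSEQ_imp_Suc) (use Q_lim in simp)
    then show "\<forall>\<^sub>F n in sequentially. Q (n - 1) < 1 / 2"
      by (rule order_tendstoD) simp
  qed (rule order_tendstoD(2)[OF Q_lim] order_tendstoD(2)[OF \<tau>_lim], simp)+
  have main: "\<forall>\<^sub>F n in sequentially. real n * \<tau> n \<le> 4 * P n"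
    using ev
  proof eventually_elim
    case (elim n)
    have \<rho>': "1 / 2 \<le> \<rho> n" using \<rho>[of n] elim by linarith
    \<comment> \<open>For large \<open>n * \<tau> n\<close> the lower bound of
      \<open>prob_sum_gt_ge\<close> with \<open>m = n\<close> is worthless. Looking for the big
      summand among fewer indices \<open>m\<close> rules this case out.\<close>
    have "real n * \<tau> n \<le> 1 / 8"
    proof (rule ccontr)
      assume "\<not> ?thesis"
      then have big: "1 / 8 < real n * \<tau> n" by simp
      \<comment> \<open>Minimality limits the overshoot to \<open>\<tau> n < 1 / 8\<close>, so
        \<open>m * \<tau> n\<close> lies between \<open>1 / 8\<close> and \<open>1 / 4\<close>,
        which forces \<open>Q n \<ge> 1 / 32\<close>.\<close>
      define m where "m = (LEAST m. 1 / 8 < real m * \<tau> n)"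
      have m: "1 / 8 < real m * \<tau> n" unfolding m_def by (rule LeastI, rule big)
      have "m \<le> n" unfolding m_def by (rule Least_le, rule big)
      have "\<not> 1 / 8 < real (m - 1) * \<tau> n"
      proof
        assume "1 / 8 < real (m - 1) * \<tau> n"
        then have "m \<le> m - 1" unfolding m_def by (rule Least_le)
        with m show False by (cases m) auto
      qed
      moreover have "real m * \<tau> n = real (m - 1) * \<tau> n + \<tau> n"
        using m by (cases m) (auto simp: distrib_right)
      ultimately have le: "real m * \<tau> n \<le> 1 / 4" using elim by linarith
      have "1 / 4 \<le> \<rho> n - real m * \<tau> n" using le \<rho>' by linarith
      with m have "1 / 8 * (1 / 4) \<le> real m * \<tau> n * (\<rho> n - real m * \<tau> n)"
        by (intro mult_mono) linarith+
      also have "\<dots> \<le> Q n" by (rule Q_ge[OF \<open>m \<le> n\<close>])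
      finally show False using elim by simp
    qed
    with \<rho>' have "1 / 4 \<le> \<rho> n - real n * \<tau> n" by linarith
    then have "real n * \<tau> n * (1 / 4) \<le> real n * \<tau> n * (\<rho> n - real n * \<tau> n)"
      by (rule mult_left_mono) (simp add: \<tau>_def)
    also have "\<dots> \<le> Q n" by (rule Q_ge) simp
    also have "\<dots> \<le> P n" by (rule QP)
    finally show ?case by simp
  qed
  have "summable (\<lambda>n. real n powr (r / p - 1) * prob {\<omega>\<in>space M. (2 * C) * real n powr (1 / p) < \<bar>Z \<omega>\<bar>})"
  proof (rule summable_comparison_test_ev[OF _ summable_mult[OF sm, of 4]])
    show "\<forall>\<^sub>F n in sequentially.
      norm (real n powr (r / p - 1) * prob {\<omega>\<in>space M. (2 * C) * real n powr (1 / p) < \<bar>Z \<omega>\<bar>}) \<le>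
      4 * (real n powr (r / p - 2) * prob {\<omega>\<in>space M. c * real n powr (1 / p) < \<bar>\<Sum>k=1..n. X k \<omega>\<bar>})"
      using main eventually_gt_at_top[of 0]
    proof eventually_elim
      case (elim n)
      have "real n powr (r / p - 1) = real n powr (r / p - 2) * real n"
        using elim powr_add[of "real n" "r / p - 2" 1] by simp
      then have "real n powr (r / p - 1) * \<tau> n = real n powr (r / p - 2) * (real n * \<tau> n)"
        by simp
      also have "\<dots> \<le> real n powr (r / p - 2) * (4 * P n)"
        using elim by (intro mult_left_mono) auto
      finally show ?case by (simp add: \<tau>_def P_def x_def mult_ac)
    qed
  qed
  then show ?thesis
    by (subst (asm) summable_tail_iff_abs_powr_integrable) (use p C in auto)
qed

end

section \<open>Sufficiency for weighted sums\<close>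

lemma exp_le_quadratic:
  fixes u v :: real
  assumes "\<bar>u\<bar> \<le> v"
  shows "exp u \<le> 1 + u + u\<^sup>2 * exp v"
proof -
  obtain t where t: "\<bar>t\<bar> \<le> \<bar>u\<bar>" "exp u = (\<Sum>m<2. u ^ m / fact m) + exp t / fact 2 * u ^ 2"
    using Maclaurin_exp_le[of u 2] by blast
  have "exp t / 2 * u\<^sup>2 \<le> exp v * u\<^sup>2"
  proof (rule mult_right_mono)
    have "exp t \<le> exp v" using t assms by simp
    then show "exp t / 2 \<le> exp v" using exp_gt_zero[of v] by linarith
  qed simp
  with t show ?thesis by (simp add: numeral_2_eq_2 mult.commute)
qed

text \<open>Cutting to 0 instead of clamping makes the discarded remainder equal to \<open>z\<close>
  itself beyond the level; the drift estimate for \<open>r \<ge> 1\<close> works with this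
  remainder.\<close>

definition trunc :: "real \<Rightarrow> real \<Rightarrow> real" where
  "trunc y z = z * of_bool (\<bar>z\<bar> \<le> y)"

lemma trunc_measurable [measurable]: "trunc y \<in> borel_measurable borel"
  unfolding trunc_def by measurable

lemma abs_trunc_le: "0 \<le> y \<Longrightarrow> \<bar>trunc y z\<bar> \<le> y"
  by (auto simp: trunc_def)

lemma trunc_eq: "\<bar>z\<bar> \<le> y \<Longrightarrow> trunc y z = z"
  by (simp add: trunc_def)

context prob_space
begin

lemma bounded_integrable:
  fixes f :: "'a \<Rightarrow> real"
  assumes [measurable]: "random_variable borel f" and f: "\<And>\<omega>. \<bar>f \<omega>\<bar> \<le> c"
  shows "integrable M f" "integrable M (\<lambda>\<omega>. (f \<omega>)\<^sup>2)"
proof -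
  show "integrable M f"
    by (rule integrable_const_bound[where B = c]) (use f in auto)
  have "(f \<omega>)\<^sup>2 \<le> c\<^sup>2" for \<omega>
    using power_mono[OF f abs_ge_zero, where n = 2] by simp
  then show "integrable M (\<lambda>\<omega>. (f \<omega>)\<^sup>2)"
    by (intro integrable_const_bound[where B = "c\<^sup>2"]) auto
qed

text \<open>Chernoff's method: Markov's inequality for \<open>exp (l * sum)\<close>, factorisation
  by independence, and \<open>exp_le_quadratic\<close> for each factor. The summands may have a
  drift \<open>\<mu>\<close>, which stays in the exponent.\<close>

lemma prob_sum_ge_exp_bound:
  fixes W :: "'i \<Rightarrow> 'a \<Rightarrow> real" and x y l B \<mu> :: real
  assumes A: "finite A" and indep: "indep_vars (\<lambda>_. borel) W A"
    and bdd: "\<And>k \<omega>. k \<in> A \<Longrightarrow> \<bar>W k \<omega>\<bar> \<le> y"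
    and mean: "\<And>k. k \<in> A \<Longrightarrow> expectation (W k) \<le> \<mu>"
    and second: "\<And>k. k \<in> A \<Longrightarrow> expectation (\<lambda>\<omega>. (W k \<omega>)\<^sup>2) \<le> B"
    and l: "0 \<le> l"
  shows "prob {\<omega>\<in>space M. x \<le> (\<Sum>k\<in>A. W k \<omega>)} \<le>
    exp (- l * x + card A * (l * \<mu> + l\<^sup>2 * B * exp (l * y)))"
proof -
  have W [measurable]: "random_variable borel (W k)" if "k \<in> A" for k
    using indep that by (auto simp: indep_vars_def)
  have sum_W [measurable]: "random_variable borel (\<lambda>\<omega>. \<Sum>k\<in>A. W k \<omega>)"
    by (intro borel_measurable_sum W)
  let ?q = "l * \<mu> + l\<^sup>2 * B * exp (l * y)"
  have int_exp: "integrable M (\<lambda>\<omega>. exp (l * W k \<omega>))" if "k \<in> A" for k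
  proof (rule integrable_const_bound[where B = "exp (l * y)"])
    have "l * W k \<omega> \<le> l * y" for \<omega>
      using bdd[OF that, of \<omega>] l by (intro mult_left_mono) auto
    then show "AE \<omega> in M. norm (exp (l * W k \<omega>)) \<le> exp (l * y)" by simp
  qed (use W[OF that] in measurable)
  have int: "integrable M (W k)" "integrable M (\<lambda>\<omega>. (W k \<omega>)\<^sup>2)" if "k \<in> A" for k
    using bounded_integrable[OF W bdd] that by auto
  have one: "expectation (\<lambda>\<omega>. exp (l * W k \<omega>)) \<le> exp ?q" if k: "k \<in> A" for k
  proof -
    have "expectation (\<lambda>\<omega>. exp (l * W k \<omega>)) \<le>
      expectation (\<lambda>\<omega>. 1 + l * W k \<omega> + l\<^sup>2 * exp (l * y) * (W k \<omega>)\<^sup>2)"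
    proof (rule integral_mono)
      fix \<omega>
      have "\<bar>l * W k \<omega>\<bar> \<le> l * y"
        using mult_left_mono[OF bdd[OF k, of \<omega>] l] l by (simp add: abs_mult)
      from exp_le_quadratic[OF this]
      show "exp (l * W k \<omega>) \<le> 1 + l * W k \<omega> + l\<^sup>2 * exp (l * y) * (W k \<omega>)\<^sup>2"
        by (simp add: power_mult_distrib mult_ac)
    qed (use int[OF k] int_exp[OF k] in auto)
    also have "\<dots> = 1 + l * expectation (W k) + l\<^sup>2 * exp (l * y) * expectation (\<lambda>\<omega>. (W k \<omega>)\<^sup>2)"
      using int[OF k] by (simp add: prob_space)
    also have "\<dots> \<le> 1 + l * \<mu> + l\<^sup>2 * exp (l * y) * B"
      using mean[OF k] second[OF k] l by (intro add_mono mult_left_mono) auto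
    also have "\<dots> \<le> exp ?q"
      using exp_ge_add_one_self[of ?q] by (simp add: mult_ac add.assoc)
    finally show ?thesis .
  qed
  have indep_exp: "indep_vars (\<lambda>_. borel) (\<lambda>k \<omega>. exp (l * W k \<omega>)) A"
    by (rule indep_vars_compose2[OF indep]) auto
  have exp_sum: "exp (l * (\<Sum>k\<in>A. W k \<omega>)) = (\<Prod>k\<in>A. exp (l * W k \<omega>))" for \<omega>
    using A by (simp add: sum_distrib_left exp_sum)
  have "prob {\<omega>\<in>space M. x \<le> (\<Sum>k\<in>A. W k \<omega>)} \<le>
    prob {\<omega>\<in>space M. exp (l * x) \<le> exp (l * (\<Sum>k\<in>A. W k \<omega>))}"
    using l by (intro finite_measure_mono) (auto intro!: mult_left_mono)
  also have "\<dots> \<le> expectation (\<lambda>\<omega>. exp (l * (\<Sum>k\<in>A. W k \<omega>))) / exp (l * x)"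
    unfolding exp_sum
    by (rule integral_Markov_inequality_measure[where A = "{}"])
      (use indep_vars_integrable[OF A indep_exp int_exp] in \<open>auto intro!: AE_I2 prod_nonneg\<close>)
  also have "expectation (\<lambda>\<omega>. exp (l * (\<Sum>k\<in>A. W k \<omega>))) = (\<Prod>k\<in>A. expectation (\<lambda>\<omega>. exp (l * W k \<omega>)))"
    unfolding exp_sum by (rule indep_vars_lebesgue_integral[OF A indep_exp int_exp])
  also have "\<dots> \<le> (\<Prod>k\<in>A. exp ?q)"
    by (intro prod_mono conjI one) auto
  also have "\<dots> = exp (card A * ?q)" by (simp add: exp_of_nat_mult)
  also have "exp (card A * ?q) / exp (l * x) = exp (- l * x + card A * ?q)"
    by (simp add: exp_diff[symmetric])
  finally show ?thesis by (simp add: divide_right_mono)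
qed

text \<open>Cross terms vanish by independence and zero means; boundedness supplies
  integrability.\<close>

lemma expectation_sum_square_le:
  fixes W :: "'i \<Rightarrow> 'a \<Rightarrow> real" and y B :: real
  assumes "finite A" "indep_vars (\<lambda>_. borel) W A"
    and "\<And>k \<omega>. k \<in> A \<Longrightarrow> \<bar>W k \<omega>\<bar> \<le> y"
    and "\<And>k. k \<in> A \<Longrightarrow> expectation (W k) = 0"
    and "\<And>k. k \<in> A \<Longrightarrow> expectation (\<lambda>\<omega>. (W k \<omega>)\<^sup>2) \<le> B"
  shows "expectation (\<lambda>\<omega>. (\<Sum>k\<in>A. W k \<omega>)\<^sup>2) \<le> card A * B"
  using assms
proof (induction A rule: finite_induct)
  case (insert i A)
  let ?S = "\<lambda>\<omega>. \<Sum>k\<in>A. W k \<omega>"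
  have W: "random_variable borel (W k)" if "k \<in> insert i A" for k
    using insert.prems(1) that unfolding indep_vars_def by blast
  have [measurable]: "random_variable borel (W i)" "random_variable borel ?S"
    by (auto intro!: borel_measurable_sum W)
  have Wb: "\<bar>W i \<omega>\<bar> \<le> y" for \<omega> using insert.prems(2) by auto
  have Sb: "\<bar>?S \<omega>\<bar> \<le> card A * y" for \<omega>
  proof -
    have "\<bar>?S \<omega>\<bar> \<le> (\<Sum>k\<in>A. \<bar>W k \<omega>\<bar>)" by (rule sum_abs)
    also have "\<dots> \<le> card A * y" by (rule sum_bounded_above) (use insert.prems(2) in auto)
    finally show ?thesis .
  qed
  have int: "integrable M (W i)" "integrable M ?S"
    and int2: "integrable M (\<lambda>\<omega>. (W i \<omega>)\<^sup>2)" "integrable M (\<lambda>\<omega>. (?S \<omega>)\<^sup>2)"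
    using bounded_integrable[of "W i" y] bounded_integrable[of ?S "card A * y"] Wb Sb by simp_all
  have iv: "indep_var borel (W i) borel ?S"
    using insert by (intro indep_vars_sum) auto
  have IH: "expectation (\<lambda>\<omega>. (?S \<omega>)\<^sup>2) \<le> card A * B"
    using insert.prems by (intro insert.IH) (auto intro: indep_vars_subset)
  have "expectation (\<lambda>\<omega>. (\<Sum>k\<in>insert i A. W k \<omega>)\<^sup>2) =
    expectation (\<lambda>\<omega>. (W i \<omega>)\<^sup>2 + (?S \<omega>)\<^sup>2 + 2 * (W i \<omega> * ?S \<omega>))"
    using insert.hyps by (simp add: power2_sum mult_ac)
  also have "\<dots> = expectation (\<lambda>\<omega>. (W i \<omega>)\<^sup>2) + expectation (\<lambda>\<omega>. (?S \<omega>)\<^sup>2) +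
      2 * expectation (\<lambda>\<omega>. W i \<omega> * ?S \<omega>)"
    using int2 indep_var_integrable[OF iv int]
    by (subst Bochner_Integration.integral_add Bochner_Integration.integral_mult_right_zero; simp)+
  also have "expectation (\<lambda>\<omega>. W i \<omega> * ?S \<omega>) = 0"
    using indep_var_lebesgue_integral[OF iv int] insert.prems(3) by simp
  finally show ?case
    using IH insert.prems(4)[of i] insert.hyps by (simp add: distrib_right)
qed simp

section \<open>The mean of the truncated variable\<close>

lemma trunc_integrable:
  assumes [measurable]: "random_variable borel Z"
  shows "integrable M (\<lambda>\<omega>. trunc y (Z \<omega>))" "integrable M (\<lambda>\<omega>. (trunc y (Z \<omega>))\<^sup>2)"
proof -
  have "\<bar>trunc y (Z \<omega>)\<bar> \<le> \<bar>y\<bar>" for \<omega> by (auto simp: trunc_def)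
  then show "integrable M (\<lambda>\<omega>. trunc y (Z \<omega>))" "integrable M (\<lambda>\<omega>. (trunc y (Z \<omega>))\<^sup>2)"
    by (auto intro!: bounded_integrable)
qed

text \<open>Equivalently, \<open>n\<close> times the truncated mean is of smaller order than
  \<open>n powr (1 / p)\<close>. Dominated convergence applies with a multiple of
  \<open>\<bar>Z\<bar> powr r\<close>: to the truncated part if \<open>r < 1\<close>, and to the
  discarded part, of opposite mean by centering, if \<open>r \<ge> 1\<close>.\<close>

lemma truncated_mean_tendsto_0:
  fixes Z :: "'a \<Rightarrow> real"
  assumes [measurable]: "random_variable borel Z"
    and p: "0 < (p::real)" "p \<le> r" and d: "0 < d"
    and int: "integrable M (\<lambda>\<omega>. \<bar>Z \<omega>\<bar> powr r)"
    and centered: "1 \<le> r \<Longrightarrow> integrable M Z \<Longrightarrow> expectation Z = 0"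
  shows "(\<lambda>n. real n powr (1 - 1 / p) * expectation (\<lambda>\<omega>. trunc (d * real n powr (1 / p)) (Z \<omega>))) \<longlonglongrightarrow> 0"
proof -
  define y where "y n = d * real n powr (1 / p)" for n
  have y_lim: "filterlim y at_top sequentially"
    unfolding y_def using p d by real_asymp
  \<comment> \<open>Split \<open>\<bar>z\<bar>\<close> as
    \<open>\<bar>z\<bar> powr (1 - r) * \<bar>z\<bar> powr r\<close>. The hypothesis holds for
    \<open>\<bar>z\<bar> \<le> y n\<close> when \<open>r < 1\<close> and beyond a positive level
    when \<open>r \<ge> 1\<close>; the remaining power \<open>n powr (1 - r / p)\<close> is at most
    1.\<close>
  have bound: "\<bar>real n powr (1 - 1 / p) * z\<bar> \<le> d powr (1 - r) * \<bar>z\<bar> powr r"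
    if "\<bar>z\<bar> powr (1 - r) \<le> y n powr (1 - r)" for z n
  proof (cases "n = 0 \<or> z = 0")
    case False
    then have n: "1 \<le> real n" and z: "z \<noteq> 0" by auto
    have "\<bar>z\<bar> = \<bar>z\<bar> powr (1 - r) * \<bar>z\<bar> powr r"
      using z by (simp add: powr_add[symmetric])
    then have "\<bar>real n powr (1 - 1 / p) * z\<bar> = real n powr (1 - 1 / p) * (\<bar>z\<bar> powr (1 - r) * \<bar>z\<bar> powr r)"
      by (simp add: abs_mult)
    also have "\<dots> \<le> real n powr (1 - 1 / p) * (y n powr (1 - r) * \<bar>z\<bar> powr r)"
      using that by (intro mult_left_mono mult_right_mono) auto
    also have "y n powr (1 - r) = d powr (1 - r) * real n powr (1 / p * (1 - r))"
      unfolding y_def by (simp add: powr_mult powr_powr)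
    also have "real n powr (1 - 1 / p) * (d powr (1 - r) * real n powr (1 / p * (1 - r)) * \<bar>z\<bar> powr r) =
      real n powr (1 - 1 / p + 1 / p * (1 - r)) * (d powr (1 - r) * \<bar>z\<bar> powr r)"
      by (simp add: powr_add)
    also have "1 - 1 / p + 1 / p * (1 - r) = 1 - r / p" by (simp add: diff_divide_distrib)
    also have "real n powr (1 - r / p) * (d powr (1 - r) * \<bar>z\<bar> powr r) \<le> 1 * (d powr (1 - r) * \<bar>z\<bar> powr r)"
    proof (rule mult_right_mono)
      have "real n powr (1 - r / p) \<le> real n powr 0"
        using n p by (intro powr_mono) auto
      then show "real n powr (1 - r / p) \<le> 1" using n by simp
    qed simp
    finally show ?thesis by simp
  qed auto
  have y_pos: "0 < y n" if "n \<noteq> 0" for n using that d by (simp add: y_def)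
  have int_w: "integrable M (\<lambda>\<omega>. d powr (1 - r) * \<bar>Z \<omega>\<bar> powr r)" using int by simp
  show ?thesis
  proof (cases "1 \<le> r")
    case False
    \<comment> \<open>Here \<open>p \<le> r < 1\<close>, so the prefactor
      \<open>n powr (1 - 1 / p)\<close> itself tends to 0.\<close>
    have "(\<lambda>n. expectation (\<lambda>\<omega>. real n powr (1 - 1 / p) * trunc (y n) (Z \<omega>))) \<longlonglongrightarrow> expectation (\<lambda>_. 0)"
    proof (rule integral_dominated_convergence[OF _ _ int_w])
      show "AE \<omega> in M. (\<lambda>n. real n powr (1 - 1 / p) * trunc (y n) (Z \<omega>)) \<longlonglongrightarrow> 0"
      proof (rule AE_I2)
        fix \<omega>
        have "(\<lambda>n. real n powr (1 - 1 / p)) \<longlonglongrightarrow> 0"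
          using p False by real_asymp
        then have "(\<lambda>n. real n powr (1 - 1 / p) * \<bar>Z \<omega>\<bar>) \<longlonglongrightarrow> 0"
          by (rule tendsto_mult_left_zero)
        then show "(\<lambda>n. real n powr (1 - 1 / p) * trunc (y n) (Z \<omega>)) \<longlonglongrightarrow> 0"
          by (rule Lim_null_comparison[rotated])
            (auto intro!: always_eventually mult_left_mono simp: abs_mult trunc_def)
      qed
      show "AE \<omega> in M. norm (real n powr (1 - 1 / p) * trunc (y n) (Z \<omega>)) \<le> d powr (1 - r) * \<bar>Z \<omega>\<bar> powr r" for n
      proof (rule AE_I2)
        fix \<omega>
        show "norm (real n powr (1 - 1 / p) * trunc (y n) (Z \<omega>)) \<le> d powr (1 - r) * \<bar>Z \<omega>\<bar> powr r"
        proof (cases "\<bar>Z \<omega>\<bar> \<le> y n")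
          case True
          then have "\<bar>Z \<omega>\<bar> powr (1 - r) \<le> y n powr (1 - r)"
            using False by (intro powr_mono2) auto
          from bound[OF this] True show ?thesis by (simp add: trunc_def)
        qed (simp add: trunc_def)
      qed
    qed measurable
    then show ?thesis by (simp add: y_def)
  next
    case True
    \<comment> \<open>Each fixed outcome is eventually below the level, so the discarded part is
      eventually 0 pointwise whatever the prefactor does.\<close>
    define R where "R n z = z * of_bool (y n < \<bar>z\<bar>)" for n z
    have [measurable]: "R n \<in> borel_measurable borel" for n unfolding R_def by measurable
    have intZ: "integrable M Z"
    proof (rule Bochner_Integration.integrable_bound[OF Bochner_Integration.integrable_add[OF int integrable_const[of 1]]])
      show "AE \<omega> in M. norm (Z \<omega>) \<le> norm (\<bar>Z \<omega>\<bar> powr r + 1)"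
      proof (rule AE_I2)
        fix \<omega>
        show "norm (Z \<omega>) \<le> norm (\<bar>Z \<omega>\<bar> powr r + 1)"
        proof (cases "1 \<le> \<bar>Z \<omega>\<bar>")
          case True': True
          then have "\<bar>Z \<omega>\<bar> powr 1 \<le> \<bar>Z \<omega>\<bar> powr r" using True by (intro powr_mono) auto
          then show ?thesis using True' by simp
        qed (use powr_ge_zero[of "\<bar>Z \<omega>\<bar>" r] in \<open>simp del: powr_ge_zero\<close>)
      qed
    qed simp
    have "(\<lambda>n. expectation (\<lambda>\<omega>. real n powr (1 - 1 / p) * R n (Z \<omega>))) \<longlonglongrightarrow> expectation (\<lambda>_. 0)"
    proof (rule integral_dominated_convergence[OF _ _ int_w])
      show "AE \<omega> in M. (\<lambda>n. real n powr (1 - 1 / p) * R n (Z \<omega>)) \<longlonglongrightarrow> 0"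
      proof (rule AE_I2)
        fix \<omega>
        have "\<forall>\<^sub>F n in sequentially. \<bar>Z \<omega>\<bar> \<le> y n"
          using y_lim unfolding filterlim_at_top by blast
        then have "\<forall>\<^sub>F n in sequentially. real n powr (1 - 1 / p) * R n (Z \<omega>) = 0"
          by eventually_elim (simp add: R_def)
        then show "(\<lambda>n. real n powr (1 - 1 / p) * R n (Z \<omega>)) \<longlonglongrightarrow> 0"
          by (rule tendsto_eventually)
      qed
      show "AE \<omega> in M. norm (real n powr (1 - 1 / p) * R n (Z \<omega>)) \<le> d powr (1 - r) * \<bar>Z \<omega>\<bar> powr r" for n
      proof (rule AE_I2)
        fix \<omega>
        show "norm (real n powr (1 - 1 / p) * R n (Z \<omega>)) \<le> d powr (1 - r) * \<bar>Z \<omega>\<bar> powr r"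
        \<comment> \<open>The level is 0 at \<open>n = 0\<close>, where the antitone power estimate
          fails; there the prefactor is 0.\<close>
        proof (cases "n \<noteq> 0 \<and> y n < \<bar>Z \<omega>\<bar>")
          case True': True
          then have "\<bar>Z \<omega>\<bar> powr (1 - r) \<le> y n powr (1 - r)"
            using True y_pos[of n] by (intro powr_mono2') auto
          from bound[OF this] True' show ?thesis by (simp add: R_def)
        qed (auto simp: R_def)
      qed
    qed measurable
    moreover have "expectation (\<lambda>\<omega>. trunc (y n) (Z \<omega>)) = - expectation (\<lambda>\<omega>. R n (Z \<omega>))" for n
    proof -
      have R: "R n z = z - trunc (y n) z" for z by (auto simp: R_def trunc_def)
      show ?thesis
        unfolding R using intZ trunc_integrable(1)[of Z "y n"] centered[OF True intZ] by simp
    qed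
    ultimately show ?thesis
      using tendsto_minus[of "\<lambda>n. real n powr (1 - 1 / p) * expectation (\<lambda>\<omega>. R n (Z \<omega>))" 0]
      by (simp add: y_def)
  qed
qed

end

lemma (in prob_space) powr_integrable_mono:
  fixes Z :: "'a \<Rightarrow> real"
  assumes [measurable]: "random_variable borel Z" and "0 < s" "s \<le> r"
    and "integrable M (\<lambda>\<omega>. \<bar>Z \<omega>\<bar> powr r)"
  shows "integrable M (\<lambda>\<omega>. \<bar>Z \<omega>\<bar> powr s)"
proof (rule Bochner_Integration.integrable_bound[OF Bochner_Integration.integrable_add[OF assms(4) integrable_const[of 1]]])
  have "\<bar>z\<bar> powr s \<le> \<bar>z\<bar> powr r + 1" for z :: real
  proof (cases "1 \<le> \<bar>z\<bar>")
    case True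
    then have "\<bar>z\<bar> powr s \<le> \<bar>z\<bar> powr r" using assms by (intro powr_mono) auto
    then show ?thesis by simp
  next
    case False
    then have "\<bar>z\<bar> powr s \<le> 1" using assms by (intro powr_le1) auto
    then show ?thesis using powr_ge_zero[of "\<bar>z\<bar>" r] by linarith
  qed
  then show "AE \<omega> in M. norm (\<bar>Z \<omega>\<bar> powr s) \<le> norm (\<bar>Z \<omega>\<bar> powr r + 1)" by simp
qed simp

section \<open>Truncation of weighted sums and the two probability bounds\<close>

context iid_sequence
begin

definition truncated_sum :: "(nat \<Rightarrow> real) \<Rightarrow> nat \<Rightarrow> real \<Rightarrow> 'a \<Rightarrow> real" where
  "truncated_sum c n y \<omega> = (\<Sum>k=1..n. c k * trunc y (X k \<omega>))"

lemma weighted_sum_measurable [measurable]: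
  fixes c :: "nat \<Rightarrow> real" and n :: nat
  assumes [measurable]: "f \<in> borel_measurable borel"
  shows "random_variable borel (\<lambda>\<omega>. \<Sum>k=1..n. c k * f (X k \<omega>))"
proof (rule borel_measurable_sum)
  fix k assume "k \<in> {1..n}"
  then have [measurable]: "random_variable borel (X k)" by (intro X_measurable) simp
  show "random_variable borel (\<lambda>\<omega>. c k * f (X k \<omega>))" by measurable
qed

lemma truncated_sum_measurable [measurable]: "random_variable borel (truncated_sum c n y)"
  unfolding truncated_sum_def[abs_def] by measurable

lemma expectation_trunc_X:
  assumes "1 \<le> k"
  shows "expectation (\<lambda>\<omega>. trunc y (X k \<omega>)) = expectation (\<lambda>\<omega>. trunc y (Z \<omega>))"
    and "expectation (\<lambda>\<omega>. (trunc y (X k \<omega>))\<^sup>2) = expectation (\<lambda>\<omega>. (trunc y (Z \<omega>))\<^sup>2)"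
  using expectation_X[OF assms, of "trunc y"] expectation_X[OF assms, of "\<lambda>z. (trunc y z)\<^sup>2"] by simp_all

text \<open>Unless some \<open>\<bar>X k\<bar>\<close> exceeds \<open>y\<close>, the sum and its
  truncation coincide; a union bound does the rest.\<close>

lemma prob_le_truncated:
  fixes c :: "nat \<Rightarrow> real" and n :: nat
  shows "prob {\<omega>\<in>space M. x < \<bar>\<Sum>k=1..n. c k * X k \<omega>\<bar>} \<le>
    n * prob {\<omega>\<in>space M. y < \<bar>Z \<omega>\<bar>} + prob {\<omega>\<in>space M. x < \<bar>truncated_sum c n y \<omega>\<bar>}"
proof -
  have [measurable]: "random_variable borel (\<lambda>\<omega>. \<Sum>k=1..n. c k * X k \<omega>)"
    using weighted_sum_measurable[of "\<lambda>z. z"] by simp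
  have U: "{\<omega>\<in>space M. y < \<bar>X k \<omega>\<bar>} \<in> events" if "1 \<le> k" for k
    using X_measurable[OF that] by measurable
  let ?U = "\<Union>k\<in>{1..n}. {\<omega>\<in>space M. y < \<bar>X k \<omega>\<bar>}"
  have "prob {\<omega>\<in>space M. x < \<bar>\<Sum>k=1..n. c k * X k \<omega>\<bar>} \<le> prob (?U \<union> {\<omega>\<in>space M. x < \<bar>truncated_sum c n y \<omega>\<bar>})"
  proof (rule finite_measure_mono)
    show "{\<omega>\<in>space M. x < \<bar>\<Sum>k=1..n. c k * X k \<omega>\<bar>} \<subseteq> ?U \<union> {\<omega>\<in>space M. x < \<bar>truncated_sum c n y \<omega>\<bar>}"
    proof
      fix \<omega> assume \<omega>: "\<omega> \<in> {\<omega>\<in>space M. x < \<bar>\<Sum>k=1..n. c k * X k \<omega>\<bar>}"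
      show "\<omega> \<in> ?U \<union> {\<omega>\<in>space M. x < \<bar>truncated_sum c n y \<omega>\<bar>}"
      proof (cases "\<omega> \<in> ?U")
        case False
        then have "truncated_sum c n y \<omega> = (\<Sum>k=1..n. c k * X k \<omega>)"
          unfolding truncated_sum_def using \<omega> by (intro sum.cong refl) (auto simp: not_less trunc_eq)
        then show ?thesis using \<omega> by simp
      qed simp
    qed
  qed (use U in \<open>auto intro!: sets.finite_UN\<close>)
  also have "\<dots> \<le> prob ?U + prob {\<omega>\<in>space M. x < \<bar>truncated_sum c n y \<omega>\<bar>}"
    using U by (intro measure_Un_le sets.finite_UN) auto
  also have "prob ?U \<le> (\<Sum>k=1..n. prob {\<omega>\<in>space M. y < \<bar>X k \<omega>\<bar>})"
    using U by (intro finite_measure_subadditive_finite) auto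
  also have "\<dots> = (\<Sum>k=1..n. prob {\<omega>\<in>space M. y < \<bar>Z \<omega>\<bar>})"
    using prob_X[of _ "{z. y < \<bar>z\<bar>}"] by (intro sum.cong refl) simp
  finally show ?thesis by simp
qed

text \<open>The shift \<open>d\<close> serves both the centered summands of the Chebyshev bound and,
  with \<open>d = 0\<close>, the uncentered ones of the exponential bound.\<close>

lemma indep_trunc: "indep_vars (\<lambda>_. borel) (\<lambda>k \<omega>. c k * trunc y (X k \<omega>) - d k) {1..n}"
  by (rule indep_vars_compose2[OF indep_vars_subset[OF indep]]) auto

lemma abs_expectation_truncated_sum_le:
  fixes c :: "nat \<Rightarrow> real" and n :: nat
  assumes c: "\<And>k. k \<in> {1..n} \<Longrightarrow> \<bar>c k\<bar> \<le> C"
  shows "\<bar>\<Sum>k=1..n. c k * expectation (\<lambda>\<omega>. trunc y (Z \<omega>))\<bar> \<le>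
    n * (C * \<bar>expectation (\<lambda>\<omega>. trunc y (Z \<omega>))\<bar>)"
proof -
  let ?m = "expectation (\<lambda>\<omega>. trunc y (Z \<omega>))"
  have "\<bar>\<Sum>k=1..n. c k * ?m\<bar> \<le> (\<Sum>k=1..n. \<bar>c k * ?m\<bar>)" by (rule sum_abs)
  also have "\<dots> \<le> of_nat (card {1..n}) * (C * \<bar>?m\<bar>)"
    by (rule sum_bounded_above) (use c in \<open>auto simp: abs_mult intro!: mult_right_mono\<close>)
  finally show ?thesis by simp
qed

text \<open>The drift uses up at most half of \<open>x\<close>, so a deviation of
  \<open>x / 2\<close> from the mean remains, whence the factor 4. Each variance is at most the
  second moment of the truncated summand.\<close>

lemma prob_truncated_sum_chebyshev:
  fixes c :: "nat \<Rightarrow> real" and n :: nat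
  assumes c: "\<And>k. k \<in> {1..n} \<Longrightarrow> \<bar>c k\<bar> \<le> C" and y: "0 \<le> y" and x: "0 < x"
    and drift: "n * (C * \<bar>expectation (\<lambda>\<omega>. trunc y (Z \<omega>))\<bar>) \<le> x / 2"
  shows "prob {\<omega>\<in>space M. x < \<bar>truncated_sum c n y \<omega>\<bar>} \<le>
    n * (C\<^sup>2 * expectation (\<lambda>\<omega>. (trunc y (Z \<omega>))\<^sup>2)) * 4 / x\<^sup>2"
proof -
  define \<mu> where "\<mu> = expectation (\<lambda>\<omega>. trunc y (Z \<omega>))"
  define B where "B = expectation (\<lambda>\<omega>. (trunc y (Z \<omega>))\<^sup>2)"
  define W where "W k \<omega> = c k * trunc y (X k \<omega>) - c k * \<mu>" for k \<omega>
  have C: "0 \<le> C" if "k \<in> {1..n}" for k using c[OF that] by linarith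
  have int: "integrable M (\<lambda>\<omega>. trunc y (X k \<omega>))" "integrable M (\<lambda>\<omega>. (trunc y (X k \<omega>))\<^sup>2)"
    if "1 \<le> k" for k using trunc_integrable[OF X_measurable[OF that]] by auto
  have \<mu>: "\<bar>\<mu>\<bar> \<le> y"
  proof -
    have "\<bar>\<mu>\<bar> \<le> expectation (\<lambda>\<omega>. \<bar>trunc y (Z \<omega>)\<bar>)" unfolding \<mu>_def by (rule integral_abs_bound)
    also have "\<dots> \<le> expectation (\<lambda>_. y)"
      by (intro integral_mono integrable_abs trunc_integrable abs_trunc_le y) auto
    finally show ?thesis by (simp add: prob_space)
  qed
  have W_bdd: "\<bar>W k \<omega>\<bar> \<le> C * (2 * y)" if k: "k \<in> {1..n}" for k \<omega>
  proof -
    have "\<bar>W k \<omega>\<bar> = \<bar>c k\<bar> * \<bar>trunc y (X k \<omega>) - \<mu>\<bar>"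
      by (simp add: W_def abs_mult[symmetric] right_diff_distrib)
    also have "\<dots> \<le> C * (2 * y)"
      using c[OF k] C[OF k] \<mu> abs_trunc_le[OF y, of "X k \<omega>"] by (intro mult_mono) auto
    finally show ?thesis .
  qed
  have W_mean: "expectation (W k) = 0" if k: "k \<in> {1..n}" for k
    unfolding W_def using int[of k] k by (simp add: expectation_trunc_X \<mu>_def prob_space)
  have W_sq: "expectation (\<lambda>\<omega>. (W k \<omega>)\<^sup>2) \<le> C\<^sup>2 * B" if k: "k \<in> {1..n}" for k
  proof -
    have "expectation (\<lambda>\<omega>. (W k \<omega>)\<^sup>2) = (c k)\<^sup>2 * variance (\<lambda>\<omega>. trunc y (X k \<omega>))"
      using k by (simp add: W_def expectation_trunc_X \<mu>_def right_diff_distrib[symmetric] power_mult_distrib)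
    also have "variance (\<lambda>\<omega>. trunc y (X k \<omega>)) = B - \<mu>\<^sup>2"
      using k int[of k] by (subst variance_eq) (auto simp: expectation_trunc_X \<mu>_def B_def)
    also have "(c k)\<^sup>2 * (B - \<mu>\<^sup>2) \<le> (c k)\<^sup>2 * B" by (intro mult_left_mono) auto
    also have "\<dots> \<le> C\<^sup>2 * B"
      using c[OF k] by (intro mult_right_mono) (auto simp: B_def intro!: abs_le_square_iff[THEN iffD1])
    finally show ?thesis .
  qed
  have W_sum: "(\<Sum>k=1..n. W k \<omega>) = truncated_sum c n y \<omega> - (\<Sum>k=1..n. c k * \<mu>)" for \<omega>
    by (simp add: W_def truncated_sum_def sum_subtractf)
  have truncated_sum_mean: "expectation (truncated_sum c n y) = (\<Sum>k=1..n. c k * \<mu>)"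
    unfolding truncated_sum_def[abs_def] using int
    by (subst Bochner_Integration.integral_sum) (auto simp: expectation_trunc_X \<mu>_def)
  have truncated_sum_bdd: "\<bar>truncated_sum c n y \<omega>\<bar> \<le> n * (C * y)" for \<omega>
  proof -
    have "\<bar>truncated_sum c n y \<omega>\<bar> \<le> (\<Sum>k=1..n. \<bar>c k * trunc y (X k \<omega>)\<bar>)" unfolding truncated_sum_def by (rule sum_abs)
    also have "\<dots> \<le> of_nat (card {1..n}) * (C * y)"
      by (rule sum_bounded_above) (use c C abs_trunc_le[OF y] in \<open>auto simp: abs_mult intro!: mult_mono\<close>)
    finally show ?thesis by simp
  qed
  have "prob {\<omega>\<in>space M. x < \<bar>truncated_sum c n y \<omega>\<bar>} \<le>
    prob {\<omega>\<in>space M. x / 2 \<le> \<bar>truncated_sum c n y \<omega> - expectation (truncated_sum c n y)\<bar>}"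
  proof (rule finite_measure_mono)
    have "\<bar>expectation (truncated_sum c n y)\<bar> \<le> x / 2"
      using abs_expectation_truncated_sum_le[of n c C y] c drift unfolding truncated_sum_mean \<mu>_def by fastforce
    then show "{\<omega>\<in>space M. x < \<bar>truncated_sum c n y \<omega>\<bar>} \<subseteq>
      {\<omega>\<in>space M. x / 2 \<le> \<bar>truncated_sum c n y \<omega> - expectation (truncated_sum c n y)\<bar>}"
      by (intro Collect_mono impI) linarith
  qed measurable
  also have "\<dots> \<le> variance (truncated_sum c n y) / (x / 2)\<^sup>2"
    using x by (intro Chebyshev_inequality bounded_integrable(2)[OF _ truncated_sum_bdd]) auto
  also have "variance (truncated_sum c n y) = expectation (\<lambda>\<omega>. (\<Sum>k=1..n. W k \<omega>)\<^sup>2)"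
    by (simp only: W_sum truncated_sum_mean)
  also have "\<dots> \<le> card {1..n} * (C\<^sup>2 * B)"
  proof (rule expectation_sum_square_le)
    show "indep_vars (\<lambda>_. borel) W {1..n}"
      unfolding W_def[abs_def] by (rule indep_trunc)
  qed (use W_bdd W_mean W_sq in auto)
  finally show ?thesis by (simp add: B_def power_divide divide_right_mono)
qed

text \<open>The one-sided exponential bound is applied to the weights \<open>c\<close> and
  \<open>- c\<close>, which gives the factor 2.\<close>

lemma prob_truncated_sum_exp_bound:
  fixes c :: "nat \<Rightarrow> real" and n :: nat
  assumes c: "\<And>k. k \<in> {1..n} \<Longrightarrow> \<bar>c k\<bar> \<le> C" and y: "0 \<le> y" and l: "0 \<le> l"
    and B: "integrable M (\<lambda>\<omega>. (Z \<omega>)\<^sup>2)"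
    and drift: "n * (C * \<bar>expectation (\<lambda>\<omega>. trunc y (Z \<omega>))\<bar>) \<le> x / 2"
  shows "prob {\<omega>\<in>space M. x < \<bar>truncated_sum c n y \<omega>\<bar>} \<le>
    2 * exp (- l * x / 2 + n * (l\<^sup>2 * (C\<^sup>2 * expectation (\<lambda>\<omega>. (Z \<omega>)\<^sup>2)) * exp (l * (C * y))))"
proof -
  define \<mu> where "\<mu> = C * \<bar>expectation (\<lambda>\<omega>. trunc y (Z \<omega>))\<bar>"
  define B where "B = C\<^sup>2 * expectation (\<lambda>\<omega>. (Z \<omega>)\<^sup>2)"
  let ?b = "exp (- l * x / 2 + n * (l\<^sup>2 * B * exp (l * (C * y))))"
  have one: "prob {\<omega>\<in>space M. x \<le> truncated_sum c n y \<omega>} \<le> ?b"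
    if c: "\<And>k. k \<in> {1..n} \<Longrightarrow> \<bar>c k\<bar> \<le> C" for c
  proof -
    have "prob {\<omega>\<in>space M. x \<le> (\<Sum>k=1..n. c k * trunc y (X k \<omega>))} \<le>
      exp (- l * x + card {1..n} * (l * \<mu> + l\<^sup>2 * B * exp (l * (C * y))))"
    proof (rule prob_sum_ge_exp_bound)
      show "indep_vars (\<lambda>_. borel) (\<lambda>k \<omega>. c k * trunc y (X k \<omega>)) {1..n}"
        using indep_trunc[of c y "\<lambda>_. 0" n] by simp
    next
      fix k \<omega> assume k: "k \<in> {1..n}"
      show "\<bar>c k * trunc y (X k \<omega>)\<bar> \<le> C * y"
        using c[OF k] abs_trunc_le[OF y, of "X k \<omega>"] by (auto simp: abs_mult intro!: mult_mono)
    next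
      fix k assume k: "k \<in> {1..n}"
      have "c k * m \<le> C * \<bar>m\<bar>" for m
        using mult_right_mono[OF c[OF k] abs_ge_zero[of m]] abs_ge_self[of "c k * m"]
        by (simp add: abs_mult)
      then show "expectation (\<lambda>\<omega>. c k * trunc y (X k \<omega>)) \<le> \<mu>"
        using k by (simp add: expectation_trunc_X \<mu>_def)
      have "expectation (\<lambda>\<omega>. (c k * trunc y (X k \<omega>))\<^sup>2) = (c k)\<^sup>2 * expectation (\<lambda>\<omega>. (trunc y (Z \<omega>))\<^sup>2)"
        using k by (simp add: power_mult_distrib expectation_trunc_X)
      also have "\<dots> \<le> C\<^sup>2 * expectation (\<lambda>\<omega>. (Z \<omega>)\<^sup>2)"
      proof (rule mult_mono)
        show "expectation (\<lambda>\<omega>. (trunc y (Z \<omega>))\<^sup>2) \<le> expectation (\<lambda>\<omega>. (Z \<omega>)\<^sup>2)"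
          by (rule integral_mono[OF trunc_integrable(2) assms(4)]) (auto simp: trunc_def)
        show "(c k)\<^sup>2 \<le> C\<^sup>2" using c[OF k] by (intro abs_le_square_iff[THEN iffD1]) auto
      qed auto
      finally show "expectation (\<lambda>\<omega>. (c k * trunc y (X k \<omega>))\<^sup>2) \<le> B" by (simp add: B_def)
    qed (use l in auto)
    also have "\<dots> \<le> ?b"
    proof -
      \<comment> \<open>The drift consumes half of the exponent \<open>l * x\<close>.\<close>
      have "l * (n * \<mu>) \<le> l * (x / 2)"
        using drift l by (intro mult_left_mono) (auto simp: \<mu>_def)
      then show ?thesis by (simp add: algebra_simps)
    qed
    finally show ?thesis by (simp add: truncated_sum_def)
  qed
  have neg: "truncated_sum (\<lambda>k. - c k) n y \<omega> = - truncated_sum c n y \<omega>" for \<omega>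
    by (simp add: truncated_sum_def sum_negf)
  have "prob {\<omega>\<in>space M. x < \<bar>truncated_sum c n y \<omega>\<bar>} \<le>
    prob ({\<omega>\<in>space M. x \<le> truncated_sum c n y \<omega>} \<union> {\<omega>\<in>space M. x \<le> truncated_sum (\<lambda>k. - c k) n y \<omega>})"
    by (intro finite_measure_mono) (auto simp: neg)
  also have "\<dots> \<le> prob {\<omega>\<in>space M. x \<le> truncated_sum c n y \<omega>} + prob {\<omega>\<in>space M. x \<le> truncated_sum (\<lambda>k. - c k) n y \<omega>}"
    by (intro measure_Un_le) measurable
  also have "\<dots> \<le> ?b + ?b"
    using c by (intro add_mono one) auto
  finally show ?thesis by (simp add: B_def)
qed

text \<open>The weights form a triangular array because those of the autoregression depend on
  \<open>n - k\<close>; a uniform bound \<open>C\<close> is all that the estimates see.\<close>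

lemma weighted_sums_summable:
  fixes c :: "nat \<Rightarrow> nat \<Rightarrow> real"
  assumes p: "0 < p" "p < 2" "p \<le> r" and e: "0 < \<epsilon>"
    and c: "\<And>n k. k \<in> {1..n} \<Longrightarrow> \<bar>c n k\<bar> \<le> C" and C: "0 < C"
    and int: "integrable M (\<lambda>\<omega>. \<bar>Z \<omega>\<bar> powr r)"
    and centered: "1 \<le> r \<Longrightarrow> integrable M Z \<Longrightarrow> expectation Z = 0"
  shows "summable (\<lambda>n. real n powr (r / p - 2) *
    prob {\<omega>\<in>space M. \<epsilon> * real n powr (1 / p) < \<bar>\<Sum>k=1..n. c n k * X k \<omega>\<bar>})"
proof -
  define x where "x n = \<epsilon> * real n powr (1 / p)" for n
  have x_pos: "0 < x n" if "0 < n" for n using e that by (simp add: x_def)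
  have pow_n: "real n powr (r / p - 2) * real n = real n powr (r / p - 1)" if "0 < n" for n
    using that powr_add[of "real n" "r / p - 2" 1] by simp
  \<comment> \<open>Writing \<open>n\<close> as \<open>n powr (1 - 1 / p) * n powr (1 / p)\<close>
    reduces this to \<open>truncated_mean_tendsto_0\<close>.\<close>
  have drift: "\<forall>\<^sub>F n in sequentially.
      n * (C * \<bar>expectation (\<lambda>\<omega>. trunc (d * real n powr (1 / p)) (Z \<omega>))\<bar>) \<le> x n / 2"
    if d: "0 < d" for d
  proof -
    define m where "m n = expectation (\<lambda>\<omega>. trunc (d * real n powr (1 / p)) (Z \<omega>))" for n
    have "(\<lambda>n. \<bar>real n powr (1 - 1 / p) * m n\<bar>) \<longlonglongrightarrow> 0"
      unfolding m_def
      by (rule tendsto_rabs_zero[OF truncated_mean_tendsto_0[OF Z_measurable p(1,3) d int centered]])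
    then have "\<forall>\<^sub>F n in sequentially. \<bar>real n powr (1 - 1 / p) * m n\<bar> < \<epsilon> / (2 * C)"
      by (rule order_tendstoD) (use e C in simp)
    then show ?thesis
      using eventually_gt_at_top[of 0] unfolding m_def[symmetric]
    proof eventually_elim
      case (elim n)
      have n: "real n = real n powr (1 - 1 / p) * real n powr (1 / p)"
        using elim by (simp add: powr_add[symmetric])
      have "real n * (C * \<bar>m n\<bar>) = C * real n powr (1 / p) * \<bar>real n powr (1 - 1 / p) * m n\<bar>"
        by (subst n) (simp add: abs_mult mult_ac)
      also have "\<dots> \<le> C * real n powr (1 / p) * (\<epsilon> / (2 * C))"
        using elim C by (intro mult_left_mono) auto
      also have "\<dots> = x n / 2" using C by (simp add: x_def)
      finally show ?case .
    qed
  qed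
  \<comment> \<open>The discarded values contribute a convergent tail series, so it remains to find
    a summable majorant \<open>g\<close> for the truncated sums.\<close>
  have reduce: "summable (\<lambda>n. real n powr (r / p - 2) *
      prob {\<omega>\<in>space M. x n < \<bar>\<Sum>k=1..n. c n k * X k \<omega>\<bar>})"
    if d: "0 < d" and ev: "\<forall>\<^sub>F n in sequentially. real n powr (r / p - 2) *
        prob {\<omega>\<in>space M. x n < \<bar>truncated_sum (c n) n (d * real n powr (1 / p)) \<omega>\<bar>} \<le> g n"
      and g: "summable g" for d g
  proof (rule summable_comparison_test_ev)
    show "summable (\<lambda>n. real n powr (r / p - 1) *
        prob {\<omega>\<in>space M. d * real n powr (1 / p) < \<bar>Z \<omega>\<bar>} + g n)"
      using summable_tail_iff_abs_powr_integrable[OF Z_measurable p(1,3) d] int g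
      by (intro summable_add) auto
    show "\<forall>\<^sub>F n in sequentially. norm (real n powr (r / p - 2) *
        prob {\<omega>\<in>space M. x n < \<bar>\<Sum>k=1..n. c n k * X k \<omega>\<bar>}) \<le>
      real n powr (r / p - 1) * prob {\<omega>\<in>space M. d * real n powr (1 / p) < \<bar>Z \<omega>\<bar>} + g n"
      using ev eventually_gt_at_top[of 0]
    proof eventually_elim
      case (elim n)
      let ?y = "d * real n powr (1 / p)"
      have "real n powr (r / p - 2) * prob {\<omega>\<in>space M. x n < \<bar>\<Sum>k=1..n. c n k * X k \<omega>\<bar>} \<le>
        real n powr (r / p - 2) * (n * prob {\<omega>\<in>space M. ?y < \<bar>Z \<omega>\<bar>} +
          prob {\<omega>\<in>space M. x n < \<bar>truncated_sum (c n) n ?y \<omega>\<bar>})"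
        by (intro mult_left_mono prob_le_truncated) auto
      also have "\<dots> = real n powr (r / p - 1) * prob {\<omega>\<in>space M. ?y < \<bar>Z \<omega>\<bar>} +
        real n powr (r / p - 2) * prob {\<omega>\<in>space M. x n < \<bar>truncated_sum (c n) n ?y \<omega>\<bar>}"
        unfolding pow_n[OF elim(2), symmetric] by (simp add: distrib_left mult_ac)
      finally show ?case using elim by simp
    qed
  qed
  show ?thesis
  proof (cases "r < 2")
    case True
    define m2 where "m2 n = expectation (\<lambda>\<omega>. (trunc (real n powr (1 / p)) (Z \<omega>))\<^sup>2)" for n
    \<comment> \<open>Chebyshev's bound has weight
      \<open>n powr (r / p - 2) * n / n powr (2 / p) = n powr (- b)\<close>, and
      \<open>b > 1\<close> because \<open>r < 2\<close>.\<close>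
    define b where "b = 1 + (2 - r) / p"
    \<comment> \<open>Taking \<open>V = \<bar>Z\<bar> powr p\<close> turns truncation at
      \<open>n powr (1 / p)\<close> into truncation at \<open>n\<close>; the moment required with
      \<open>s = 2 / p\<close> is \<open>V powr (r / p) = \<bar>Z\<bar> powr r\<close>.\<close>
    have "summable (\<lambda>n. real n powr (- b) *
        expectation (\<lambda>\<omega>. (\<bar>Z \<omega>\<bar> powr p) powr (2 / p) * of_bool (\<bar>Z \<omega>\<bar> powr p \<le> real n)))"
    proof (rule summable_truncated_moment)
      have "p * (2 / p + 1 - b) = r" using p by (simp add: b_def field_simps)
      then show "integrable M (\<lambda>\<omega>. (\<bar>Z \<omega>\<bar> powr p) powr (2 / p + 1 - b))"
        using int by (simp add: powr_powr)
    qed (use p True in \<open>auto simp: b_def\<close>)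
    moreover have "(\<bar>z\<bar> powr p) powr (2 / p) * of_bool (\<bar>z\<bar> powr p \<le> real n) =
        (trunc (real n powr (1 / p)) z)\<^sup>2" for z :: real and n
    proof -
      have "\<bar>z\<bar> powr p \<le> real n \<longleftrightarrow> \<bar>z\<bar> \<le> real n powr (1 / p)"
        using less_powr_iff[of "1 / p" "real n" "\<bar>z\<bar> powr p"] less_powr_iff[of p "real n" "\<bar>z\<bar>"] p
        by (simp flip: not_less)
      then show ?thesis using p by (simp add: trunc_def powr_powr)
    qed
    ultimately have sm: "summable (\<lambda>n. real n powr (- b) * m2 n)" by (simp add: m2_def)
    show ?thesis
    proof (rule reduce[of 1, unfolded x_def])
      show "summable (\<lambda>n. 4 * C\<^sup>2 / \<epsilon>\<^sup>2 * (real n powr (- b) * m2 n))"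
        by (rule summable_mult[OF sm])
      show "\<forall>\<^sub>F n in sequentially. real n powr (r / p - 2) *
          prob {\<omega>\<in>space M. \<epsilon> * real n powr (1 / p) < \<bar>truncated_sum (c n) n (1 * real n powr (1 / p)) \<omega>\<bar>} \<le>
        4 * C\<^sup>2 / \<epsilon>\<^sup>2 * (real n powr (- b) * m2 n)"
        using drift[of 1, OF zero_less_one] eventually_gt_at_top[of 0]
      proof eventually_elim
        case (elim n)
        have "prob {\<omega>\<in>space M. x n < \<bar>truncated_sum (c n) n (real n powr (1 / p)) \<omega>\<bar>} \<le>
          n * (C\<^sup>2 * m2 n) * 4 / (x n)\<^sup>2"
          unfolding m2_def
          by (rule prob_truncated_sum_chebyshev) (use c x_pos elim in auto)
        then have "real n powr (r / p - 2) * prob {\<omega>\<in>space M. x n < \<bar>truncated_sum (c n) n (real n powr (1 / p)) \<omega>\<bar>} \<le>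
          real n powr (r / p - 2) * (n * (C\<^sup>2 * m2 n) * 4 / (x n)\<^sup>2)"
          by (rule mult_left_mono) simp
        also have "\<dots> = real n powr (r / p - 2) * real n / (real n powr (1 / p))\<^sup>2 * (4 * C\<^sup>2 / \<epsilon>\<^sup>2 * m2 n)"
          by (simp add: x_def power_mult_distrib field_simps)
        also have "real n powr (r / p - 2) * real n / (real n powr (1 / p))\<^sup>2 = real n powr (- b)"
        proof -
          have "(real n powr (1 / p))\<^sup>2 = real n powr (2 / p)"
            using elim by (simp add: powr_powr flip: powr_numeral)
          moreover have "r / p - 1 - 2 / p = - b" by (simp add: b_def diff_divide_distrib)
          ultimately show ?thesis by (simp add: pow_n[OF elim(2)] flip: powr_diff)
        qed
        finally show ?case by (simp add: x_def mult_ac)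
      qed
    qed simp
  next
    case False
    define B where "B = C\<^sup>2 * expectation (\<lambda>\<omega>. (Z \<omega>)\<^sup>2)"
    define K where "K = r / p"
    \<comment> \<open>The truncation level will be \<open>\<delta> * x n / C\<close>. This
      \<open>\<delta>\<close> makes \<open>exp (l n * (C * y))\<close> equal to
      \<open>n powr ((2 / p - 1) / 2)\<close>, spending half of the gap between the exponents 1 and
      \<open>2 / p\<close>.\<close>
    define \<delta> where "\<delta> = (2 / p - 1) / (4 * K)"
    have K: "1 \<le> K" using p by (simp add: K_def)
    have gap: "1 < 2 / p" using p by simp
    have \<delta>: "0 < \<delta>" using K gap by (simp add: \<delta>_def)
    have intZ2: "integrable M (\<lambda>\<omega>. (Z \<omega>)\<^sup>2)"
      using powr_integrable_mono[OF Z_measurable, of 2 r] int False by simp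
    \<comment> \<open>Tuned so that \<open>exp (- l n * x n / 2) = n powr (- K)\<close>; against the
      weight \<open>n powr (K - 2)\<close> this leaves \<open>n powr (-2)\<close>.\<close>
    define l where "l n = 2 * K * ln (real n) / x n" for n
    \<comment> \<open>This is the variance term in the exponent, in simplified form: the unspent
      half of the gap beats the squared logarithm.\<close>
    have main: "\<forall>\<^sub>F n in sequentially.
      4 * K\<^sup>2 * B / \<epsilon>\<^sup>2 * ((ln (real n))\<^sup>2 * real n powr (- ((2 / p - 1) / 2))) \<le> 1"
    proof -
      have "(\<lambda>n. (ln (real n))\<^sup>2 * real n powr (- ((2 / p - 1) / 2))) \<longlonglongrightarrow> 0"
        using gap by real_asymp
      from tendsto_mult_right_zero[OF this, of "4 * K\<^sup>2 * B / \<epsilon>\<^sup>2"]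
      have "\<forall>\<^sub>F n in sequentially.
        4 * K\<^sup>2 * B / \<epsilon>\<^sup>2 * ((ln (real n))\<^sup>2 * real n powr (- ((2 / p - 1) / 2))) < 1"
        by (rule order_tendstoD) simp
      then show ?thesis by eventually_elim simp
    qed
    define d where "d = \<epsilon> * \<delta> / C"
    have d: "0 < d" using e \<delta> C by (simp add: d_def)
    show ?thesis
    proof (rule reduce[OF d, unfolded x_def])
      show "summable (\<lambda>n. 2 * exp 1 * real n powr (-2))"
        by (intro summable_mult) (simp add: summable_real_powr_iff)
      show "\<forall>\<^sub>F n in sequentially. real n powr (r / p - 2) *
          prob {\<omega>\<in>space M. \<epsilon> * real n powr (1 / p) < \<bar>truncated_sum (c n) n (d * real n powr (1 / p)) \<omega>\<bar>} \<le>
        2 * exp 1 * real n powr (-2)"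
        using drift[OF d] main eventually_gt_at_top[of 0]
      proof eventually_elim
        case (elim n)
        let ?y = "d * real n powr (1 / p)"
        have x: "0 < x n" using x_pos elim by simp
        have l: "0 \<le> l n" using elim K x by (simp add: l_def)
        have lx: "- l n * x n / 2 = - K * ln (real n)" using x by (simp add: l_def)
        have "C * ?y = \<delta> * x n" using C by (simp add: d_def x_def)
        then have "l n * (C * ?y) = 2 * K * \<delta> * ln (real n)" using x by (simp add: l_def)
        also have "2 * K * \<delta> = (2 / p - 1) / 2" using K by (simp add: \<delta>_def)
        finally have ly: "exp (l n * (C * ?y)) = real n powr ((2 / p - 1) / 2)"
          using elim by (simp add: powr_def)
        have l2: "(l n)\<^sup>2 = 4 * K\<^sup>2 / \<epsilon>\<^sup>2 * (ln (real n))\<^sup>2 * real n powr (- 2 / p)"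
        proof -
          have "(real n powr (1 / p))\<^sup>2 = real n powr (2 / p)"
            using elim by (simp add: powr_powr flip: powr_numeral)
          then show ?thesis
            by (simp add: l_def x_def power_divide power_mult_distrib powr_minus divide_inverse power_inverse mult_ac)
        qed
        have pw: "real n * real n powr (- 2 / p) * real n powr ((2 / p - 1) / 2) =
          real n powr (- ((2 / p - 1) / 2))"
        proof -
          have "real n * real n powr (- 2 / p) * real n powr ((2 / p - 1) / 2) =
            real n powr (1 + - 2 / p + (2 / p - 1) / 2)"
            by (simp only: powr_add powr_one of_nat_0_le_iff)
          also have "1 + - 2 / p + (2 / p - 1) / 2 = - ((2 / p - 1) / 2)"
            by (simp add: field_simps)
          finally show ?thesis .
        qed
        have "n * ((l n)\<^sup>2 * B * exp (l n * (C * ?y))) =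
          4 * K\<^sup>2 * B / \<epsilon>\<^sup>2 * ((ln (real n))\<^sup>2 * (real n * real n powr (- 2 / p) * real n powr ((2 / p - 1) / 2)))"
          unfolding l2 ly by (simp add: mult_ac)
        also have "\<dots> \<le> 1" unfolding pw by (rule elim(2))
        finally have "exp (- l n * x n / 2 + n * ((l n)\<^sup>2 * B * exp (l n * (C * ?y)))) \<le> exp (- K * ln (real n) + 1)"
          unfolding lx by simp
        also have "\<dots> = exp 1 * real n powr (- K)" using elim(3) by (simp add: powr_def flip: exp_add)
        finally have "prob {\<omega>\<in>space M. x n < \<bar>truncated_sum (c n) n ?y \<omega>\<bar>} \<le> 2 * (exp 1 * real n powr (- K))"
          using prob_truncated_sum_exp_bound[of n "c n" C ?y "l n" "x n", OF c _ l intZ2 elim(1)] d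
          by (simp add: B_def)
        then have "real n powr (r / p - 2) * prob {\<omega>\<in>space M. x n < \<bar>truncated_sum (c n) n ?y \<omega>\<bar>} \<le>
          real n powr (r / p - 2) * (2 * (exp 1 * real n powr (- K)))"
          by (rule mult_left_mono) simp
        also have "\<dots> = 2 * exp 1 * real n powr (r / p - 2 + - K)"
          by (simp only: powr_add mult_ac)
        finally show ?case by (simp add: x_def K_def)
      qed
    qed
  qed
qed

end

section \<open>The autoregression\<close>

text \<open>This is the coefficient of \<open>\<theta>s k\<close> in \<open>S (k + j)\<close>: the
  innovation enters \<open>\<xi> (k + i)\<close> with weight \<open>q ^ i\<close>.\<close>

definition geom_sum :: "real \<Rightarrow> nat \<Rightarrow> real" where
  "geom_sum q j = (\<Sum>i<Suc j. q ^ i)"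

text \<open>The closed form has a numerator between 0 and 2, even at \<open>q = -1\<close>, where
  the weights alternate between 1 and 0.\<close>

lemma abs_geom_sum_le:
  assumes "-1 \<le> q" "q < 1"
  shows "\<bar>geom_sum q j\<bar> \<le> 2 / (1 - q)"
proof -
  have "geom_sum q j = (1 - q ^ Suc j) / (1 - q)"
    using one_diff_power_eq[of q "Suc j"] assms by (simp add: geom_sum_def field_simps)
  moreover have "\<bar>q ^ Suc j\<bar> \<le> 1"
    unfolding power_abs using assms by (intro power_le_one) auto
  then have "\<bar>1 - q ^ Suc j\<bar> \<le> 2" by linarith
  ultimately show ?thesis using assms by (simp add: divide_right_mono)
qed

lemma geom_sum_Suc: "geom_sum q (Suc j) = 1 + q * geom_sum q j"
  unfolding geom_sum_def by (subst sum.lessThan_Suc_shift) (simp add: sum_distrib_left distrib_left)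

text \<open>Horner's step for \<open>geom_sum\<close>. Read forwards it unrolls the recursion;
  solved for the last sum it recovers the i.i.d. partial sums from two consecutive
  \<open>S\<close>.\<close>

lemma weighted_geom_sum_Suc:
  "(\<Sum>k=1..Suc n. geom_sum q (Suc n - k) * t k) =
    q * (\<Sum>k=1..n. geom_sum q (n - k) * t k) + (\<Sum>k=1..Suc n. t k)"
proof -
  have "(\<Sum>k=1..n. geom_sum q (Suc n - k) * t k) = (\<Sum>k=1..n. q * (geom_sum q (n - k) * t k) + t k)"
    by (intro sum.cong) (auto simp: Suc_diff_le geom_sum_Suc algebra_simps)
  then show ?thesis
    by (simp add: sum.distrib sum_distrib_left geom_sum_def)
qed

lemma sum_autoregression:
  fixes x t :: "nat \<Rightarrow> real"
  assumes "x 1 = t 1" "\<And>k. 2 \<le> k \<Longrightarrow> x k = q * x (k - 1) + t k"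
  shows "(\<Sum>k=1..n. x k) = (\<Sum>k=1..n. geom_sum q (n - k) * t k)"
proof (induction n)
  case (Suc n)
  \<comment> \<open>Summing the recursion shows that the partial sums of \<open>x\<close> obey the
    same recursion as the weighted sums.\<close>
  have "(\<Sum>k=1..Suc n. x k) = q * (\<Sum>k=1..n. x k) + (\<Sum>k=1..Suc n. t k)"
  proof (induction n)
    case (Suc n)
    have "q * (\<Sum>k=1..Suc n. x k) = q * (\<Sum>k=1..n. x k) + q * x (Suc n)"
      by (simp add: distrib_left)
    then show ?case
      using Suc.IH assms(2)[of "Suc (Suc n)"]
      by (simp only: sum.cl_ivl_Suc[of _ 1 "Suc n"]) simp
  qed (use assms(1) in simp)
  then show ?case by (simp only: Suc.IH weighted_geom_sum_Suc)
qed simp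

text \<open>The exponent \<open>r / p - 2\<close> may have either sign:
  \<open>Suc n \<le> 2 * n\<close> settles a nonnegative one, monotonicity a negative one.\<close>

lemma Suc_powr_le:
  assumes "1 \<le> n"
  shows "real (Suc n) powr a \<le> 2 powr \<bar>a\<bar> * real n powr a"
proof (cases "0 \<le> a")
  case True
  have "real (Suc n) powr a \<le> (2 * real n) powr a"
    using assms True by (intro powr_mono2) auto
  then show ?thesis using True by (simp add: powr_mult)
next
  case False
  have "real (Suc n) powr a \<le> 1 * real n powr a"
    using assms False by (simp add: powr_mono2')
  also have "\<dots> \<le> 2 powr \<bar>a\<bar> * real n powr a"
    by (intro mult_right_mono ge_one_powr_ge_zero) auto
  finally show ?thesis .
qed

context iid_sequence
begin

text \<open>The i.i.d. sum of \<open>Suc n\<close> terms is \<open>S (Suc n) - q * S n\<close>, and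
  \<open>\<bar>q\<bar> \<le> 1\<close>. If it exceeds twice a level, one of the two \<open>S\<close>
  exceeds the level, so \<open>partial_sums_imp_integrable\<close> applies with
  \<open>2 * \<epsilon>\<close>.\<close>

lemma autoregression_sums_imp_integrable:
  assumes q: "\<bar>q\<bar> \<le> 1" and p: "0 < p" "p \<le> r" and e: "0 < \<epsilon>"
    and sm: "summable (\<lambda>n. real n powr (r / p - 2) *
      prob {\<omega>\<in>space M. \<epsilon> * real n powr (1 / p) < \<bar>\<Sum>k=1..n. geom_sum q (n - k) * X k \<omega>\<bar>})"
  shows "integrable M (\<lambda>\<omega>. \<bar>Z \<omega>\<bar> powr r)"
proof -
  define a where "a = r / p - 2"
  define S where "S n \<omega> = (\<Sum>k=1..n. geom_sum q (n - k) * X k \<omega>)" for n \<omega>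
  define P where "P n = prob {\<omega>\<in>space M. \<epsilon> * real n powr (1 / p) < \<bar>S n \<omega>\<bar>}" for n
  have P0: "0 \<le> P n" for n by (simp add: P_def)
  have sm: "summable (\<lambda>n. real n powr a * P n)" using sm by (simp add: P_def S_def a_def)
  have shifted: "summable (\<lambda>n. real (Suc n) powr a * P n)"
  proof (rule summable_comparison_test'[OF summable_mult[OF sm, of "2 powr \<bar>a\<bar>"], of 1])
    fix n :: nat assume "1 \<le> n"
    from mult_right_mono[OF Suc_powr_le[OF this, of a] P0[of n]]
    show "norm (real (Suc n) powr a * P n) \<le> 2 powr \<bar>a\<bar> * (real n powr a * P n)"
      using P0[of n] by (simp add: mult_ac)
  qed
  have [measurable]: "random_variable borel (S n)" for n
    unfolding S_def[abs_def] using weighted_sum_measurable[of "\<lambda>z. z"] by simp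
  have le: "prob {\<omega>\<in>space M. 2 * \<epsilon> * real (Suc n) powr (1 / p) < \<bar>\<Sum>k=1..Suc n. X k \<omega>\<bar>} \<le>
    P (Suc n) + P n" for n
  proof -
    have "prob {\<omega>\<in>space M. 2 * \<epsilon> * real (Suc n) powr (1 / p) < \<bar>\<Sum>k=1..Suc n. X k \<omega>\<bar>} \<le>
      prob ({\<omega>\<in>space M. \<epsilon> * real (Suc n) powr (1 / p) < \<bar>S (Suc n) \<omega>\<bar>} \<union>
        {\<omega>\<in>space M. \<epsilon> * real n powr (1 / p) < \<bar>S n \<omega>\<bar>})"
    proof (rule finite_measure_mono)
      show "{\<omega>\<in>space M. 2 * \<epsilon> * real (Suc n) powr (1 / p) < \<bar>\<Sum>k=1..Suc n. X k \<omega>\<bar>} \<subseteq>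
        {\<omega>\<in>space M. \<epsilon> * real (Suc n) powr (1 / p) < \<bar>S (Suc n) \<omega>\<bar>} \<union>
        {\<omega>\<in>space M. \<epsilon> * real n powr (1 / p) < \<bar>S n \<omega>\<bar>}"
      proof
        fix \<omega> assume \<omega>: "\<omega> \<in> {\<omega>\<in>space M. 2 * \<epsilon> * real (Suc n) powr (1 / p) < \<bar>\<Sum>k=1..Suc n. X k \<omega>\<bar>}"
        have "(\<Sum>k=1..Suc n. X k \<omega>) = S (Suc n) \<omega> - q * S n \<omega>"
          unfolding S_def by (subst weighted_geom_sum_Suc) simp
        moreover have "\<bar>q * S n \<omega>\<bar> \<le> \<bar>S n \<omega>\<bar>"
          using q by (simp add: abs_mult mult_left_le_one_le)
        moreover have "\<epsilon> * real n powr (1 / p) \<le> \<epsilon> * real (Suc n) powr (1 / p)"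
          using e p by (intro mult_left_mono powr_mono2) auto
        ultimately have "\<epsilon> * real (Suc n) powr (1 / p) < \<bar>S (Suc n) \<omega>\<bar> \<or> \<epsilon> * real n powr (1 / p) < \<bar>S n \<omega>\<bar>"
          using \<omega> by (auto simp del: of_nat_Suc sum.cl_ivl_Suc)
        then show "\<omega> \<in> {\<omega>\<in>space M. \<epsilon> * real (Suc n) powr (1 / p) < \<bar>S (Suc n) \<omega>\<bar>} \<union>
          {\<omega>\<in>space M. \<epsilon> * real n powr (1 / p) < \<bar>S n \<omega>\<bar>}" using \<omega> by auto
      qed
    qed measurable
    also have "\<dots> \<le> P (Suc n) + P n"
      unfolding P_def by (intro measure_Un_le) measurable
    finally show ?thesis .
  qed
  have "summable (\<lambda>n. real (Suc n) powr a * P (Suc n) + real (Suc n) powr a * P n)"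
    using sm shifted by (intro summable_add) (simp_all add: summable_Suc_iff[of "\<lambda>n. real n powr a * P n"] del: of_nat_Suc)
  then have "summable (\<lambda>n. real (Suc n) powr a *
    prob {\<omega>\<in>space M. 2 * \<epsilon> * real (Suc n) powr (1 / p) < \<bar>\<Sum>k=1..Suc n. X k \<omega>\<bar>})"
  proof (rule summable_comparison_test'[of _ 0])
    fix n :: nat
    from mult_left_mono[OF le[of n] powr_ge_zero[of "real (Suc n)" a]]
    show "norm (real (Suc n) powr a *
      prob {\<omega>\<in>space M. 2 * \<epsilon> * real (Suc n) powr (1 / p) < \<bar>\<Sum>k=1..Suc n. X k \<omega>\<bar>}) \<le>
      real (Suc n) powr a * P (Suc n) + real (Suc n) powr a * P n"
      by (simp add: distrib_left del: of_nat_Suc sum.cl_ivl_Suc)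
  qed
  then have "summable (\<lambda>n. real n powr a *
    prob {\<omega>\<in>space M. 2 * \<epsilon> * real n powr (1 / p) < \<bar>\<Sum>k=1..n. X k \<omega>\<bar>})"
    by (rule summable_Suc_iff[THEN iffD1])
  from partial_sums_imp_integrable[OF p _ this[unfolded a_def]] e show ?thesis by simp
qed

end

theorem theorem2p1:
  fixes M :: "'a measure"
    and \<theta> :: "'a \<Rightarrow> real"
    and \<theta>s \<xi> S :: "nat \<Rightarrow> 'a \<Rightarrow> real"
    and q p r \<epsilon> :: real
  assumes "prob_space M"
    and "-1 \<le> q" "q < 1"
    and "0 < p" "p < 2"
    and "p \<le> r"
    and "\<theta> \<in> borel_measurable M"
    and "prob_space.indep_vars M (\<lambda>_. borel) \<theta>s {1..}"
    and "\<And>k. k \<ge> 1 \<Longrightarrow> distr M borel (\<theta>s k) = distr M borel \<theta>"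
    and "\<And>\<omega>. \<omega> \<in> space M \<Longrightarrow> \<xi> 1 \<omega> = \<theta>s 1 \<omega>"
    and "\<And>k \<omega>. k \<ge> 2 \<Longrightarrow> \<omega> \<in> space M \<Longrightarrow> \<xi> k \<omega> = q * \<xi> (k - 1) \<omega> + \<theta>s k \<omega>"
    and "\<And>n \<omega>. n \<ge> 1 \<Longrightarrow> \<omega> \<in> space M \<Longrightarrow> S n \<omega> = (\<Sum>k=1..n. \<xi> k \<omega>)"
    and "r \<ge> 1 \<Longrightarrow> integrable M (\<lambda>\<omega>. \<bar>\<theta> \<omega>\<bar>) \<Longrightarrow> (\<integral>\<omega>. \<theta> \<omega> \<partial>M) = 0"
    and "\<epsilon> > 0"
  shows "(\<lambda>n::nat. real n powr (r / p - 2) *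
            measure M {\<omega> \<in> space M. \<bar>S n \<omega>\<bar> / real n powr (1 / p) > \<epsilon>}) summable_on {1..}
         \<longleftrightarrow> integrable M (\<lambda>\<omega>. \<bar>\<theta> \<omega>\<bar> powr r)"
proof -
  interpret iid_sequence M \<theta>s \<theta>
    using assms(1,7,8,9) by (simp add: iid_sequence_def iid_sequence_axioms_def)
  let ?P = "\<lambda>n. real n powr (r / p - 2) * prob {\<omega>\<in>space M.
    \<epsilon> * real n powr (1 / p) < \<bar>\<Sum>k=1..n. geom_sum q (n - k) * \<theta>s k \<omega>\<bar>}"
  have S: "S n \<omega> = (\<Sum>k=1..n. geom_sum q (n - k) * \<theta>s k \<omega>)" if "1 \<le> n" "\<omega> \<in> space M" for n \<omega>
    using sum_autoregression[of "\<lambda>k. \<xi> k \<omega>" "\<lambda>k. \<theta>s k \<omega>" q n] assms(10,11,12) that by simp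
  \<comment> \<open>The index 0 may be added because its weight \<open>0 powr (r / p - 2)\<close> is
    0.\<close>
  have "(\<lambda>n::nat. real n powr (r / p - 2) *
      measure M {\<omega> \<in> space M. \<bar>S n \<omega>\<bar> / real n powr (1 / p) > \<epsilon>}) summable_on {1..} \<longleftrightarrow>
    ?P summable_on UNIV"
  proof (rule summable_on_cong_neutral)
    fix n :: nat assume n: "n \<in> {1..} \<inter> UNIV"
    then have "{\<omega> \<in> space M. \<bar>S n \<omega>\<bar> / real n powr (1 / p) > \<epsilon>} =
      {\<omega>\<in>space M. \<epsilon> * real n powr (1 / p) < \<bar>\<Sum>k=1..n. geom_sum q (n - k) * \<theta>s k \<omega>\<bar>}"
      by (intro Collect_cong conj_cong refl) (simp add: S pos_less_divide_eq)
    then show "real n powr (r / p - 2) *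
      measure M {\<omega> \<in> space M. \<bar>S n \<omega>\<bar> / real n powr (1 / p) > \<epsilon>} = ?P n" by simp
  qed auto
  \<comment> \<open>For nonnegative terms unordered and ordinary summability agree.\<close>
  also have "\<dots> \<longleftrightarrow> summable ?P"
    by (rule summable_on_UNIV_nonneg_real_iff) simp
  also have "\<dots> \<longleftrightarrow> integrable M (\<lambda>\<omega>. \<bar>\<theta> \<omega>\<bar> powr r)"
  proof
    assume "summable ?P"
    then show "integrable M (\<lambda>\<omega>. \<bar>\<theta> \<omega>\<bar> powr r)"
      using assms by (intro autoregression_sums_imp_integrable[of q p r \<epsilon>]) auto
  next
    assume "integrable M (\<lambda>\<omega>. \<bar>\<theta> \<omega>\<bar> powr r)"
    then show "summable ?P"
      using assms
      by (intro weighted_sums_summable[where C = "2 / (1 - q)"] abs_geom_sum_le) auto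
  qed
  finally show ?thesis .
qed

end
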